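(* Let $2\le k\le n$, let $\Omega\subset\mathbb R^n$ be a bounded smooth uniformly convex domain, and let $f\in C^\infty(\overline\Omega)$ satisfy $f\ge c_0>0$. For every fixed $E\in\mathrm{Gr}(k-1,n)$, with $V=E^\perp$ and $\phi_E(x)=\frac12|P_Ex|^2$, $$\lim_{t\to\infty}t^{k-1}\big(\Lambda_f(t\phi_E|_{\partial\Omega})-t\,\partial_\nu\phi_E\big)=\partial_\nu w_E^f$$ locally uniformly on $\Gamma_E=\{x\in\partial\Omega:|P_V\nu(x)|>0\}$, where $w_E^f\in C^\infty(\overline\Omega)$ is the smooth fiberwise Poisson correction characterized by $\Delta_Vw_E^f=f$ in $\Omega$, $w_E^f=0$ on $\partial\Omega$.
   Context: For a symmetric matrix $M$, $\sigma_j(M)$ is the $j$-th elementary symmetric function of its eigenvalues; $\Gamma_k=\{\lambda\in\mathbb R^n:\sigma_j(\lambda)>0,\ 1\le j\le k\}$; a $C^2$ function $u$ is $k$-admissible if the eigenvalues of $D^2u(x)$ lie in $\Gamma_k$ for all $x\in\Omega$. Uniformly convex means that all principal curvatures of $\partial\Omega$ are bounded below by a positive constant. For $g\in C^\infty(\partial\Omega)$, $u_g\in C^\infty(\overline\Omega)$ is the unique smooth $k$-admissible solution of $\sigma_k(D^2u_g)=f$ in $\Omega$, $u_g=g$ on $\partial\Omega$ (existence and uniqueness: Caffarelli–Nirenberg–Spruck), and $\Lambda_f(g)=\partial_\nu u_g|_{\partial\Omega}$ with $\nu$ the outward unit normal. $\mathrm{Gr}(m,n)$ is the Grassmannian of $m$-dimensional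 linear subspaces; $P_E,P_V$ are orthogonal projections. $\Delta_Vu=\mathrm{tr}(P_VD^2u)$ is the Laplacian in the $V$ directions. On each section $\Omega\cap(y+V)$, $y\in P_E(\Omega)$, $w_E^f$ is the solution of the Dirichlet problem $\Delta_Vw=f$ with zero boundary value on the boundary of the section in $y+V$; these solutions together form a function in $C^\infty(\overline\Omega)$. *)

theory Defs
  imports "HOL-Analysis.Analysis"
begin

section \<open>Smooth functions\<close>

definition pderiv_dir :: "'n \<Rightarrow> (real^'n::finite \<Rightarrow> real) \<Rightarrow> real^'n \<Rightarrow> real" where
  "pderiv_dir i u = (\<lambda>x. frechet_derivative u (at x) (axis i 1))"

fun iter_pderiv :: "'n list \<Rightarrow> (real^'n::finite \<Rightarrow> real) \<Rightarrow> real^'n \<Rightarrow> real" where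
  "iter_pderiv [] u = u"
| "iter_pderiv (i # is) u = pderiv_dir i (iter_pderiv is u)"

definition gradient :: "(real^'n::finite \<Rightarrow> real) \<Rightarrow> real^'n \<Rightarrow> real^'n" where
  "gradient u x = (\<chi> i. pderiv_dir i u x)"

definition hessian :: "(real^'n::finite \<Rightarrow> real) \<Rightarrow> real^'n \<Rightarrow> real^'n^'n" where
  "hessian u x = (\<chi> i j. pderiv_dir i (pderiv_dir j u) x)"

text \<open>Meant for open \<open>U\<close>.\<close>

definition Ck_on :: "nat \<Rightarrow> (real^'n::finite) set \<Rightarrow> (real^'n \<Rightarrow> real) \<Rightarrow> bool" where
  "Ck_on m U u \<longleftrightarrow>
     (\<forall>is. length is < m \<longrightarrow> (\<forall>x\<in>U. iter_pderiv is u differentiable (at x))) \<and>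
     (\<forall>is. length is \<le> m \<longrightarrow> continuous_on U (iter_pderiv is u))"

definition smooth_on :: "(real^'n::finite) set \<Rightarrow> (real^'n \<Rightarrow> real) \<Rightarrow> bool" where
  "smooth_on U u \<longleftrightarrow> (\<forall>m. Ck_on m U u)"

text \<open>The space \<open>C\<^sup>\<infinity>\<close> of the closure of an open set \<open>\<Omega>\<close>: all partial derivatives on \<open>\<Omega>\<close> extend
  continuously to the closure, and \<open>u\<close> itself takes its continuous boundary values.\<close>

definition smooth_on_closure :: "(real^'n::finite) set \<Rightarrow> (real^'n \<Rightarrow> real) \<Rightarrow> bool" where
  "smooth_on_closure \<Omega> u \<longleftrightarrow>
     smooth_on \<Omega> u \<and> continuous_on (closure \<Omega>) u \<and>
     (\<forall>is. \<exists>v. continuous_on (closure \<Omega>) v \<and> (\<forall>x\<in>\<Omega>. v x = iter_pderiv is u x))"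

text \<open>Smoothness on a (not open) subset such as a hypersurface: locally the restriction of a
  smooth function of the ambient space.\<close>

definition smooth_on_subset :: "(real^'n::finite) set \<Rightarrow> (real^'n \<Rightarrow> real) \<Rightarrow> bool" where
  "smooth_on_subset S g \<longleftrightarrow>
     (\<forall>p\<in>S. \<exists>U G. open U \<and> p \<in> U \<and> smooth_on U G \<and> (\<forall>x\<in>S \<inter> U. G x = g x))"

section \<open>Smooth uniformly convex domains\<close>

definition local_defining_function ::
  "(real^'n::finite) set \<Rightarrow> real^'n \<Rightarrow> (real^'n) set \<Rightarrow> (real^'n \<Rightarrow> real) \<Rightarrow> bool" where
  "local_defining_function \<Omega> p U \<rho> \<longleftrightarrow>
     open U \<and> p \<in> U \<and> smooth_on U \<rho> \<and> (\<forall>x\<in>U. gradient \<rho> x \<noteq> 0) \<and>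
     \<Omega> \<inter> U = {x\<in>U. \<rho> x < 0} \<and> frontier \<Omega> \<inter> U = {x\<in>U. \<rho> x = 0}"

definition smooth_bounded_domain :: "(real^'n::finite) set \<Rightarrow> bool" where
  "smooth_bounded_domain \<Omega> \<longleftrightarrow>
     open \<Omega> \<and> connected \<Omega> \<and> \<Omega> \<noteq> {} \<and> bounded \<Omega> \<and>
     (\<forall>p\<in>frontier \<Omega>. \<exists>U \<rho>. local_defining_function \<Omega> p U \<rho>)"

definition outward_normal :: "(real^'n::finite) set \<Rightarrow> real^'n \<Rightarrow> real^'n" where
  "outward_normal \<Omega> p =
     (THE \<nu>. \<exists>U \<rho>. local_defining_function \<Omega> p U \<rho> \<and>
                   \<nu> = gradient \<rho> p /\<^sub>R norm (gradient \<rho> p))"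

text \<open>Principal curvatures are the eigenvalues of the shape operator \<open>d\<nu>\<close> on the tangent space
  \<open>\<nu>(p)\<^sup>\<bottom>\<close>; with the outward normal, a sphere of radius \<open>R\<close> has principal curvatures \<open>1/R\<close>.
  The derivative \<open>L\<close> along the boundary is determined on tangent vectors only, and is applied
  only to those.\<close>

definition principal_curvature :: "(real^'n::finite) set \<Rightarrow> real^'n \<Rightarrow> real \<Rightarrow> bool" where
  "principal_curvature \<Omega> p \<kappa> \<longleftrightarrow>
     (\<exists>L \<xi>. (outward_normal \<Omega> has_derivative L) (at p within frontier \<Omega>) \<and>
            \<xi> \<noteq> 0 \<and> orthogonal \<xi> (outward_normal \<Omega> p) \<and> L \<xi> = \<kappa> *\<^sub>R \<xi>)"

definition uniformly_convex :: "(real^'n::finite) set \<Rightarrow> bool" where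
  "uniformly_convex \<Omega> \<longleftrightarrow>
     (\<exists>\<kappa>\<^sub>0>0. \<forall>p\<in>frontier \<Omega>. \<forall>\<kappa>. principal_curvature \<Omega> p \<kappa> \<longrightarrow> \<kappa>\<^sub>0 \<le> \<kappa>)"

text \<open>A one-sided derivative, since \<open>u\<close> is only meaningful on the closure of \<open>\<Omega>\<close>.\<close>

definition normal_derivative ::
  "(real^'n::finite) set \<Rightarrow> (real^'n \<Rightarrow> real) \<Rightarrow> real^'n \<Rightarrow> real" where
  "normal_derivative \<Omega> u x =
     vector_derivative (\<lambda>s. u (x + s *\<^sub>R outward_normal \<Omega> x)) (at_left 0)"

section \<open>The \<open>k\<close>-Hessian equation and its Dirichlet-to-Neumann map\<close>

definition elem_sym :: "nat \<Rightarrow> real^'n::finite \<Rightarrow> real" where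
  "elem_sym j \<mu> = (\<Sum>S\<in>{S. card S = j}. \<Prod>i\<in>S. \<mu> $ i)"

definition Gamma_cone :: "nat \<Rightarrow> (real^'n::finite) set" where
  "Gamma_cone k = {\<mu>. \<forall>j\<in>{1..k}. 0 < elem_sym j \<mu>}"

text \<open>The eigenvalues with multiplicity, as the roots of the characteristic polynomial. They are
  determined up to order only; all uses below are symmetric. Meant for symmetric matrices, for which
  all the roots are real.\<close>

definition eigenvalues :: "real^'n^'n::finite \<Rightarrow> real^'n" where
  "eigenvalues M = (SOME \<mu>. \<forall>x. det (mat x - M) = (\<Prod>i\<in>UNIV. x - \<mu> $ i))"

definition sigma :: "nat \<Rightarrow> real^'n^'n::finite \<Rightarrow> real" where
  "sigma j M = elem_sym j (eigenvalues M)"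

definition k_admissible :: "nat \<Rightarrow> (real^'n::finite) set \<Rightarrow> (real^'n \<Rightarrow> real) \<Rightarrow> bool" where
  "k_admissible k \<Omega> u \<longleftrightarrow> Ck_on 2 \<Omega> u \<and> (\<forall>x\<in>\<Omega>. eigenvalues (hessian u x) \<in> Gamma_cone k)"

definition hessian_dirichlet_solution ::
  "nat \<Rightarrow> (real^'n::finite) set \<Rightarrow> (real^'n \<Rightarrow> real) \<Rightarrow> (real^'n \<Rightarrow> real) \<Rightarrow> (real^'n \<Rightarrow> real) \<Rightarrow> bool"
  where
  "hessian_dirichlet_solution k \<Omega> f g u \<longleftrightarrow>
     smooth_on_closure \<Omega> u \<and> k_admissible k \<Omega> u \<and>
     (\<forall>x\<in>\<Omega>. sigma k (hessian u x) = f x) \<and> (\<forall>x\<in>frontier \<Omega>. u x = g x)"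

text \<open>\<open>\<Lambda>\<close> is the Dirichlet-to-Neumann map. The solution exists and is unique on the closure of \<open>\<Omega>\<close>
  by Caffarelli, Nirenberg and Spruck, so such a \<open>\<Lambda>\<close> exists, and the values of \<open>\<Lambda> g\<close> on the boundary
  are determined for every smooth \<open>g\<close>.\<close>

definition is_dirichlet_to_neumann ::
  "nat \<Rightarrow> (real^'n::finite) set \<Rightarrow> (real^'n \<Rightarrow> real) \<Rightarrow>
   ((real^'n \<Rightarrow> real) \<Rightarrow> real^'n \<Rightarrow> real) \<Rightarrow> bool" where
  "is_dirichlet_to_neumann k \<Omega> f \<Lambda> \<longleftrightarrow>
     (\<forall>g. smooth_on_subset (frontier \<Omega>) g \<longrightarrow>
        (\<exists>u. hessian_dirichlet_solution k \<Omega> f g u \<and>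
             (\<forall>x\<in>frontier \<Omega>. \<Lambda> g x = normal_derivative \<Omega> u x)))"

section \<open>Projections and the fiberwise Poisson problem\<close>

definition orth_proj :: "(real^'n::finite) set \<Rightarrow> real^'n \<Rightarrow> real^'n" where
  "orth_proj S x = (THE p. p \<in> S \<and> x - p \<in> orthogonal_comp S)"

definition phi :: "(real^'n::finite) set \<Rightarrow> real^'n \<Rightarrow> real" where
  "phi E x = (norm (orth_proj E x))\<^sup>2 / 2"

definition laplacian_along ::
  "(real^'n::finite) set \<Rightarrow> (real^'n \<Rightarrow> real) \<Rightarrow> real^'n \<Rightarrow> real" where
  "laplacian_along V u x = trace (matrix (orth_proj V) ** hessian u x)"

definition fiberwise_poisson_correction ::
  "(real^'n::finite) set \<Rightarrow> (real^'n) set \<Rightarrow> (real^'n \<Rightarrow> real) \<Rightarrow> (real^'n \<Rightarrow> real) \<Rightarrow> bool" where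
  "fiberwise_poisson_correction \<Omega> V f w \<longleftrightarrow>
     smooth_on_closure \<Omega> w \<and>
     (\<forall>x\<in>\<Omega>. laplacian_along V w x = f x) \<and> (\<forall>x\<in>frontier \<Omega>. w x = 0)"

definition nontangential_boundary :: "(real^'n::finite) set \<Rightarrow> (real^'n) set \<Rightarrow> (real^'n) set" where
  "nontangential_boundary \<Omega> V = {x\<in>frontier \<Omega>. norm (orth_proj V (outward_normal \<Omega> x)) > 0}"

definition locally_uniform_limit ::
  "'a::topological_space set \<Rightarrow> ('b \<Rightarrow> 'a \<Rightarrow> 'c::metric_space) \<Rightarrow> ('a \<Rightarrow> 'c) \<Rightarrow> 'b filter \<Rightarrow> bool" where
  "locally_uniform_limit S F l net \<longleftrightarrow>
     (\<forall>p\<in>S. \<exists>U. open U \<and> p \<in> U \<and> uniform_limit (S \<inter> U) F l net)"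

end

theory Submission
  imports Defs "HOL-Computational_Algebra.Fundamental_Theorem_Algebra"
begin

text \<open>Since \<open>\<sigma>\<^sub>k\<close> is a polynomial and \<open>P\<^sub>E\<close> has rank \<open>k - 1\<close>, the function \<open>b\<^sub>a = t \<phi>\<^sub>E + a t\<^sup>1\<^sup>-\<^sup>k w\<close>
  satisfies \<open>\<sigma>\<^sub>k(D\<^sup>2 b\<^sub>a) = a \<Delta>\<^sub>V w + O(t\<^sup>-\<^sup>k) = a f + O(t\<^sup>-\<^sup>k)\<close> uniformly on \<open>\<Omega>\<close>. As \<open>f \<ge> c\<^sub>0 > 0\<close>, for
  large \<open>t\<close> it is a \<open>k\<close>-admissible strict subsolution for \<open>a = 1 + \<eta>\<close> and a strict supersolution
  for \<open>a = 1 - \<eta>\<close>, with the boundary values of the solution, and a comparison principle squeezes the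
  normal derivative of the solution between those of the two barriers. Comparison rests on the
  monotonicity of \<open>\<sigma>\<^sub>k\<close> on the cone: a rank one increase \<open>c \<xi> \<xi>\<^sup>T\<close> of a diagonal matrix changes
  \<open>\<sigma>\<^sub>j\<close> by \<open>c\<close> times a nonnegative combination of the \<open>\<sigma>\<^bsub>j-1\<^esub>\<close> with one eigenvalue removed, and
  these are positive by Newton's inequality.\<close>

section \<open>Real-rooted polynomials and Newton's inequality\<close>

text \<open>\<open>sigma\<close> is built on chosen eigenvalues, whose dependence on the matrix is
  hard to control. For symmetric matrices it is therefore replaced by \<open>minor_sum\<close>, the
  characteristic coefficients up to sign: a polynomial in the entries, invariant under orthogonal
  conjugation. Expanding the barriers then becomes finite algebra with an explicit remainder instead
  of eigenvalue perturbation. The Hessian of a barrier is \<open>t\<close> times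
  \<open>P_E + \<epsilon> A\<close> with \<open>A = a D\<^sup>2 w\<close> and
  \<open>\<epsilon> = t\<^sup>-\<^sup>k\<close>. Since \<open>P_E\<close> has rank
  \<open>k - 1\<close>, the \<open>k\<close>-th minor sum of the bracket begins with
  \<open>\<epsilon> tr (P_V A)\<close>, and the factor \<open>t\<^sup>k\<close> brings it back to
  order one. The normalization \<open>t\<^sup>1\<^sup>-\<^sup>k\<close> is
  \<open>t \<epsilon>\<close>. The supersolution may lie outside the cone: for
  \<open>\<eta> = 1\<close> it is \<open>t \<phi>\<^sub>E\<close>, whose
  \<open>\<sigma>\<^sub>k\<close> vanishes. So monotonicity must assume positivity of the smaller
  matrix alone, and the difference is added one rank one term at a time, each leaving the sum in the
  cone. Strictness, bought by \<open>\<eta> c\<^sub>0 > K / t\<close>, lets comparison follow from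
  the second order condition at an interior maximum.\<close>

definition real_rooted :: "complex poly \<Rightarrow> bool" where
  "real_rooted p \<longleftrightarrow> (\<exists>c B. p = smult (of_real c) (\<Prod>x\<in>#B. [:- of_real x, 1:]))"

lemma poly_pderiv_linear_factors:
  fixes z :: "'a::{field_char_0}"
  assumes "z \<notin># A"
  shows "poly (pderiv (\<Prod>x\<in>#A. [:-x, 1:])) z
           = poly (\<Prod>x\<in>#A. [:-x, 1:]) z * (\<Sum>x\<in>#A. 1 / (z - x))"
  using assms
proof (induction A)
  case (add x A)
  then have "z - x \<noteq> 0" by auto
  with add show ?case
    by (simp add: pderiv_mult pderiv_pCons field_simps del: mult_pCons_left mult_pCons_right)
qed (simp add: pderiv_1)

text \<open>The argument of Gauss and Lucas: the logarithmic derivative is a sum of terms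
  \<open>1 / (z - x)\<close> whose imaginary parts all have the sign opposite to that of \<open>Im z\<close>.\<close>

lemma sum_inverse_distance_nonzero:
  fixes z :: complex
  assumes "Im z \<noteq> 0" "B \<noteq> {#}"
  shows "(\<Sum>x\<in>#B. 1 / (z - of_real x)) \<noteq> 0"
proof -
  have summand: "Im (1 / (z - of_real x)) * Im z < 0" for x
  proof -
    have "(Re z - x)\<^sup>2 + (Im z)\<^sup>2 > 0" "(Im z)\<^sup>2 > 0"
      using assms(1) by (auto simp: add_nonneg_pos)
    then show ?thesis
      by (simp add: Im_divide' cmod_power2 divide_less_0_iff flip: power2_eq_square)
  qed
  have "Im (\<Sum>x\<in>#B. 1 / (z - of_real x)) * Im z < 0" using assms(2)
  proof (induction B)
    case (add x B)
    show ?case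
    proof (cases "B = {#}")
      case True
      then show ?thesis using summand by simp
    next
      case False
      then show ?thesis using add summand[of x]
        by (auto simp: ring_distribs simp del: Im_divide intro: add_neg_neg)
    qed
  qed simp
  then show ?thesis by auto
qed

lemma real_rooted_imp_real:
  assumes "real_rooted p" "p \<noteq> 0" "poly p z = 0"
  shows "Im z = 0"
proof -
  obtain c B where p: "p = smult (of_real c) (\<Prod>x\<in>#B. [:- of_real x, 1:])"
    using assms(1) unfolding real_rooted_def by blast
  then have "poly (\<Prod>x\<in>#B. [:- of_real x, 1:]) z = 0" using assms by auto
  then have "\<exists>x\<in>#B. z = of_real x"
    by (induction B) auto
  then show ?thesis by auto
qed

text \<open>At a nonreal point \<open>p\<close> does not vanish and the logarithmic derivative is
  nonzero, so all zeros of \<open>pderiv p\<close> are real. The fundamental theorem of algebra then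
  supplies the factorization; this is why the polynomials are complex although all data are
  real.\<close>

lemma real_rooted_pderiv:
  assumes "real_rooted p"
  shows "real_rooted (pderiv p)"
proof -
  obtain c B where p: "p = smult (of_real c) (\<Prod>x\<in>#B. [:- of_real x, 1:])"
    using assms unfolding real_rooted_def by blast
  let ?Q = "\<Prod>x\<in>#B. [:- complex_of_real x, 1:]"
  let ?A = "image_mset complex_of_real B"
  have Q: "?Q = (\<Prod>x\<in>#?A. [:-x, 1:])" by (simp add: image_mset.compositionality comp_def)
  have monic: "lead_coeff ?Q = 1" by (induction B) (simp_all add: lead_coeff_mult del: mult_pCons_left mult_pCons_right)
  show ?thesis
  proof (cases "c = 0 \<or> B = {#}")
    case True
    then have "pderiv p = 0" using p by (auto simp: pderiv_smult pderiv_1)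
    \<comment> \<open>The definition admits \<open>c = 0\<close>, so the zero polynomial counts as
      real-rooted and repeated differentiation never leaves the class.\<close>
    then show ?thesis unfolding real_rooted_def by (intro exI[of _ 0]) simp
  next
    case False
    have roots: "Im z = 0" if z: "poly (pderiv p) z = 0" for z
    proof (rule ccontr)
      assume im: "Im z \<noteq> 0"
      have "z \<notin># ?A" using im by auto
      then have "poly (pderiv ?Q) z = poly ?Q z * (\<Sum>x\<in>#?A. 1 / (z - x))"
        unfolding Q by (rule poly_pderiv_linear_factors)
      moreover have "(\<Sum>x\<in>#?A. 1 / (z - x)) \<noteq> 0"
        using sum_inverse_distance_nonzero[OF im, of B] False by (simp add: image_mset.compositionality comp_def)
      moreover have "?Q \<noteq> 0" using monic by auto
      then have "poly ?Q z \<noteq> 0"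
        using real_rooted_imp_real[of ?Q z] im unfolding real_rooted_def by (metis of_real_1 smult_1_left)
      ultimately show False using z p False by (simp add: pderiv_smult)
    qed
    \<comment> \<open>The zero polynomial would vanish at the nonreal point
      \<open>\<i>\<close>.\<close>
    have nz: "pderiv p \<noteq> 0" using roots[of \<i>] by auto
    define C where "C = image_mset Re (proots (pderiv p))"
    have "image_mset complex_of_real C = image_mset (\<lambda>x. x) (proots (pderiv p))"
      unfolding C_def image_mset.compositionality comp_def
      by (intro image_mset_cong) (use roots nz in \<open>auto simp: complex_eq_iff\<close>)
    then have "(\<Prod>x\<in>#C. [:- complex_of_real x, 1:]) = (\<Prod>x\<in>#proots (pderiv p). [:-x, 1:])"
      by (metis (no_types, lifting) image_mset.compositionality comp_def image_mset_cong multiset.map_ident)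
    then have "pderiv p = smult (lead_coeff (pderiv p)) (\<Prod>x\<in>#C. [:- complex_of_real x, 1:])"
      using complex_poly_decompose_multiset by simp
    moreover have "lead_coeff (pderiv p) = of_real (of_nat (degree p) * c)"
      using monic nz False by (cases "degree p") (auto simp: coeff_pderiv degree_pderiv pderiv_eq_0_iff p)
    ultimately show ?thesis unfolding real_rooted_def by metis
  qed
qed

lemma coeff_of_real_linear_factors:
  "coeff (\<Prod>x\<in>#B. [:- complex_of_real x, 1:]) n = of_real (coeff (\<Prod>x\<in>#B. [:-x, 1:]) n)"
proof (induction B arbitrary: n)
  case (add x B)
  then show ?case by (cases n) (simp_all add: coeff_pCons)
qed (simp add: coeff_1)

text \<open>The right side is \<open>p'\<^sup>2 - p p''\<close> at 0, which for nonzero roots equals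
  \<open>p(0)\<^sup>2\<close> times the sum of their inverse squares. The induction avoids the
  division: a new root \<open>x\<close> turns the expression \<open>L\<close> of \<open>q\<close>
  into \<open>q(0)\<^sup>2 + x\<^sup>2 L\<close>.\<close>

lemma Laguerre_inequality:
  fixes p :: "real poly"
  assumes p: "p = (\<Prod>x\<in>#B. [:-x, 1:])"
  shows "0 \<le> (coeff p 1)\<^sup>2 - 2 * coeff p 0 * coeff p 2"
  unfolding p
proof (induction B)
  case (add x B)
  let ?q = "\<Prod>x\<in>#B. [:-x, 1:]"
  have "(coeff ([:-x,1:] * ?q) 1)\<^sup>2 - 2 * coeff ([:-x,1:] * ?q) 0 * coeff ([:-x,1:] * ?q) 2
     = (coeff ?q 0)\<^sup>2 + x\<^sup>2 * ((coeff ?q 1)\<^sup>2 - 2 * coeff ?q 0 * coeff ?q 2)"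
    by (simp add: coeff_pCons numeral_2_eq_2 power2_eq_square algebra_simps)
  then show ?case using add by (simp del: mult_pCons_left mult_pCons_right)
qed (simp add: numeral_2_eq_2)

lemma real_rooted_coeff_inequality:
  assumes "real_rooted p"
    and "coeff p 0 = of_real a" "coeff p 1 = of_real b" "coeff p 2 = of_real d"
  shows "2 * a * d \<le> b\<^sup>2"
proof -
  obtain c B where p: "p = smult (of_real c) (\<Prod>x\<in>#B. [:- of_real x, 1:])"
    using assms(1) unfolding real_rooted_def by blast
  define q where "q = (\<Prod>x\<in>#B. [:-x, 1:])"
  have "coeff p n = of_real (c * coeff q n)" for n
    unfolding p q_def by (simp add: coeff_of_real_linear_factors)
  then have "a = c * coeff q 0" "b = c * coeff q 1" "d = c * coeff q 2"
    using assms(2-4) of_real_eq_iff by metis+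
  then have "b\<^sup>2 - 2 * a * d = c\<^sup>2 * ((coeff q 1)\<^sup>2 - 2 * coeff q 0 * coeff q 2)"
    by (simp add: power2_eq_square algebra_simps)
  then show ?thesis using Laguerre_inequality[OF q_def]
    by (metis diff_ge_0_iff_ge mult_nonneg_nonneg zero_le_power2)
qed

section \<open>Elementary symmetric functions\<close>

text \<open>In contrast to \<open>elem_sym\<close>, the index set is a parameter, so that a single
  eigenvalue can be removed.\<close>

definition esym :: "nat \<Rightarrow> 'a set \<Rightarrow> ('a \<Rightarrow> real) \<Rightarrow> real" where
  "esym j A \<mu> = (\<Sum>S | S \<subseteq> A \<and> card S = j. \<Prod>i\<in>S. \<mu> i)"

lemma esym_0: "finite A \<Longrightarrow> esym 0 A \<mu> = 1"
proof -
  assume "finite A"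
  then have "{S. S \<subseteq> A \<and> card S = 0} = {{}}" by (auto dest: finite_subset)
  then show ?thesis unfolding esym_def by simp
qed

lemma esym_gt_card: "finite A \<Longrightarrow> card A < j \<Longrightarrow> esym j A \<mu> = 0"
  unfolding esym_def by (rule sum.neutral) (auto dest: card_mono)

lemma esym_insert:
  assumes "finite A" "i \<notin> A"
  shows "esym (Suc j) (insert i A) \<mu> = esym (Suc j) A \<mu> + \<mu> i * esym j A \<mu>"
proof -
  have fin: "finite S" if "S \<subseteq> A" for S using that assms finite_subset by blast
  have split: "{S. S \<subseteq> insert i A \<and> card S = Suc j} =
      {S. S \<subseteq> A \<and> card S = Suc j} \<union> insert i ` {S. S \<subseteq> A \<and> card S = j}" (is "?L = ?A \<union> ?B")
  proof (intro equalityI subsetI)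
    fix S assume S: "S \<in> ?L"
    show "S \<in> ?A \<union> ?B"
    proof (cases "i \<in> S")
      case True
      then have "S = insert i (S - {i})" "S - {i} \<subseteq> A" "card (S - {i}) = j"
        using S by auto
      then show ?thesis by blast
    next
      case False
      then show ?thesis using S by blast
    qed
  next
    fix S assume "S \<in> ?A \<union> ?B"
    then show "S \<in> ?L"
    proof
      assume "S \<in> ?B"
      then obtain R where R: "S = insert i R" "R \<subseteq> A" "card R = j" by blast
      then have "i \<notin> R" "finite R" using assms fin by auto
      then show ?thesis using R by auto
    qed auto
  qed
  have inj: "inj_on (insert i) {S. S \<subseteq> A \<and> card S = j}"
    by (rule inj_onI) (metis (mono_tags, lifting) assms(2) insert_ident mem_Collect_eq subsetD)
  have "(\<Sum>S\<in>?B. prod \<mu> S) = (\<Sum>S | S \<subseteq> A \<and> card S = j. \<mu> i * prod \<mu> S)"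
    unfolding sum.reindex[OF inj] comp_def
    by (rule sum.cong) (use assms(2) fin in \<open>auto intro!: prod.insert\<close>)
  moreover have "sum (prod \<mu>) (?A \<union> ?B) = sum (prod \<mu>) ?A + sum (prod \<mu>) ?B"
    by (rule sum.union_disjoint) (use assms in auto)
  ultimately show ?thesis
    unfolding esym_def split by (simp add: sum_distrib_left)
qed

text \<open>Vieta's formulas; taking the roots to be \<open>- \<mu> i\<close> keeps signs out of
  them.\<close>

lemma coeff_prod_linear_esym:
  assumes "finite A"
  shows "j \<le> card A \<Longrightarrow> coeff (\<Prod>i\<in>A. [:\<mu> i, 1:]) (card A - j) = esym j A \<mu>"
  using assms
proof (induction A arbitrary: j rule: finite_induct)
  case empty
  then show ?case by (simp add: esym_0)
next
  case (insert i A)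
  let ?P = "\<Prod>i\<in>A. [:\<mu> i, 1:]"
  have deg: "degree ?P = card A"
    by (subst degree_prod_eq_sum_degree) auto
  show ?case
  proof (cases j)
    case 0
    then show ?thesis using insert insert.IH[of 0] deg by (simp add: esym_0 coeff_eq_0)
  next
    case (Suc l)
    show ?thesis
    proof (cases "l = card A")
      case True
      then show ?thesis using Suc insert insert.IH[of l] by (simp add: esym_insert esym_gt_card)
    next
      case False
      then have l: "l < card A" using insert Suc by auto
      then have "card A - l = Suc (card A - Suc l)" by simp
      then show ?thesis using Suc l insert insert.IH[of l] insert.IH[of "Suc l"]
        by (simp add: esym_insert)
    qed
  qed
qed

lemma coeff_prod_linear_of_real:
  "finite A \<Longrightarrow> coeff (\<Prod>i\<in>A. [:complex_of_real (\<mu> i), 1:]) n = of_real (coeff (\<Prod>i\<in>A. [:\<mu> i, 1:]) n)"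
proof (induction A arbitrary: n rule: finite_induct)
  case (insert x B)
  then show ?case by (cases n) (simp_all add: coeff_pCons)
qed (simp add: coeff_1)

lemma real_rooted_prod_linear:
  assumes "finite A"
  shows "real_rooted (\<Prod>i\<in>A. [:complex_of_real (\<mu> i), 1:])"
  unfolding real_rooted_def
proof (intro exI)
  have "(\<Prod>x\<in>#image_mset (\<lambda>i. - \<mu> i) (mset_set A). [:- complex_of_real x, 1:])
      = (\<Prod>i\<in>A. [:complex_of_real (\<mu> i), 1:])"
    by (simp add: image_mset.compositionality comp_def prod_unfold_prod_mset)
  then show "(\<Prod>i\<in>A. [:complex_of_real (\<mu> i), 1:]) = smult (of_real 1)
      (\<Prod>x\<in>#image_mset (\<lambda>i. - \<mu> i) (mset_set A). [:- complex_of_real x, 1:])" by simp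
qed

text \<open>Differentiating the generating polynomial \<open>card A - j - 2\<close> times brings the three consecutive
  coefficients to the degrees 0, 1 and 2.\<close>

lemma Newton_inequality:
  assumes "finite A"
  shows "esym j A \<mu> * esym (j + 2) A \<mu> \<le> (esym (j + 1) A \<mu>)\<^sup>2"
proof (cases "j + 2 \<le> card A")
  case False
  then show ?thesis using assms by (simp add: esym_gt_card)
next
  case True
  let ?P = "\<Prod>i\<in>A. [:complex_of_real (\<mu> i), 1:]"
  define m where "m = card A - (j + 2)"
  define q where "q = (pderiv ^^ m) ?P"
  have "real_rooted ((pderiv ^^ l) ?P)" for l
    by (induction l) (simp_all add: real_rooted_prod_linear[OF assms] real_rooted_pderiv)
  then have rr: "real_rooted q" by (simp add: q_def)
  have e: "coeff ?P (card A - l) = of_real (esym l A \<mu>)" if "l \<le> card A" for l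
    using coeff_prod_linear_of_real[OF assms] coeff_prod_linear_esym[OF assms that] by simp
  have m: "m = card A - (j + 2)" "1 + m = card A - (j + 1)" "2 + m = card A - j"
    using True by (auto simp: m_def)
  \<comment> \<open>Differentiating \<open>m\<close> times multiplies the coefficient that lands in
    degree \<open>n\<close> by \<open>pochhammer (n + 1) m\<close>; these are its values for
    \<open>n\<close> = 0, 1, 2.\<close>
  have ph: "pochhammer (1::real) m = fact m"
    "pochhammer (2::real) m = fact (m + 1)"
    "pochhammer (3::real) m = fact (m + 2) / 2"
    using pochhammer_rec[of "1::real" m] pochhammer_rec[of "1::real" "Suc m"] pochhammer_rec[of "2::real" m]
    by (simp_all add: pochhammer_fact)
  have c: "coeff q n = of_real (pochhammer (of_nat (Suc n)) m) * coeff ?P (n + m)" for n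
    unfolding q_def coeff_higher_pderiv by (simp add: pochhammer_of_real[symmetric])
  have "coeff q 0 = of_real (fact m * esym (j + 2) A \<mu>)"
       "coeff q 1 = of_real (fact (m + 1) * esym (j + 1) A \<mu>)"
    using True m e[of "j+1"] e[of "j+2"] c[of 0] c[of 1] ph by simp_all
  moreover have "coeff q 2 = of_real (pochhammer 3 m * esym j A \<mu>)"
    using True m(3) e[of j] c[of 2] by simp
  then have "coeff q 2 = of_real (fact (m + 2) / 2 * esym j A \<mu>)"
    by (simp only: ph)
  ultimately have "2 * (fact m * esym (j + 2) A \<mu>) * (fact (m + 2) / 2 * esym j A \<mu>)
      \<le> (fact (m + 1) * esym (j + 1) A \<mu>)\<^sup>2"
    by (rule real_rooted_coeff_inequality[OF rr])
  then
  have "fact m * fact (m + 2) * (esym (j + 2) A \<mu> * esym j A \<mu>) \<le> (fact (m + 1))\<^sup>2 * (esym (j + 1) A \<mu>)\<^sup>2"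
    by (simp add: power_mult_distrib mult_ac del: fact_Suc)
  moreover have "fact (m + 2) = real (m + 2) * fact (m + 1)" "fact (m + 1) = real (m + 1) * fact m" by simp_all
  ultimately have "(fact m)\<^sup>2 * real (m + 1) * (real (m + 2) * (esym (j + 2) A \<mu> * esym j A \<mu>))
     \<le> (fact m)\<^sup>2 * real (m + 1) * (real (m + 1) * (esym (j + 1) A \<mu>)\<^sup>2)"
    by (simp only: power2_eq_square mult_ac)
  moreover have "(fact m)\<^sup>2 * real (m + 1) > 0" by simp
  ultimately have *: "real (m + 2) * (esym (j + 2) A \<mu> * esym j A \<mu>) \<le> real (m + 1) * (esym (j + 1) A \<mu>)\<^sup>2"
    by (rule mult_left_le_imp_le)
  show ?thesis
  proof (cases "esym (j + 2) A \<mu> * esym j A \<mu> \<le> 0")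
    case True
    then show ?thesis by (simp add: mult.commute) (meson order_trans zero_le_power2)
  next
    case False
    have "real (m + 1) * (esym (j + 2) A \<mu> * esym j A \<mu>) \<le> real (m + 2) * (esym (j + 2) A \<mu> * esym j A \<mu>)"
      using False by (intro mult_right_mono) auto
    then have "real (m + 1) * (esym (j + 2) A \<mu> * esym j A \<mu>) \<le> real (m + 1) * (esym (j + 1) A \<mu>)\<^sup>2"
      using * by linarith
    then show ?thesis by (simp add: mult.commute)
  qed
qed

text \<open>With consecutive values \<open>a > 0\<close>, \<open>b\<close>, \<open>c\<close> on
  \<open>A\<close>, suppose \<open>b \<le> 0\<close>. Subtracting
  \<open>b (b + \<mu> i a) \<le> 0\<close> from \<open>a (c + \<mu> i b) > 0\<close> eliminates
  \<open>\<mu> i\<close> and leaves \<open>a c > b\<^sup>2\<close>, against Newton. One order is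
  lost because the bound for \<open>b\<close> uses the next order of the full set.\<close>

lemma esym_remove_pos:
  assumes "finite A" "i \<notin> A" and pos: "\<And>j. j \<le> k \<Longrightarrow> 0 < esym j (insert i A) \<mu>"
  shows "j < k \<Longrightarrow> 0 < esym j A \<mu>"
proof (induction j)
  case 0
  then show ?case using assms by (simp add: esym_0)
next
  case (Suc j)
  let ?a = "esym j A \<mu>" and ?b = "esym (Suc j) A \<mu>" and ?c = "esym (Suc (Suc j)) A \<mu>"
  have a: "?a > 0" using Suc by simp
  have 1: "?b + \<mu> i * ?a > 0" "?c + \<mu> i * ?b > 0"
    using pos[of "Suc j"] pos[of "Suc (Suc j)"] Suc.prems esym_insert[OF assms(1,2)] by auto
  have N: "?a * ?c \<le> ?b\<^sup>2" using Newton_inequality[OF assms(1), of j \<mu>] by (simp add: numeral_2_eq_2)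
  show ?case
  proof (rule ccontr)
    assume "\<not> 0 < ?b"
    then have b: "?b \<le> 0" by simp
    have "?a * (?c + \<mu> i * ?b) > 0" using a 1 by simp
    moreover have "?b * (?b + \<mu> i * ?a) \<le> 0" using b 1 by (simp add: mult_nonpos_nonneg)
    ultimately show False using N by (simp add: power2_eq_square algebra_simps)
  qed
qed

section \<open>Sums of principal minors\<close>

text \<open>The determinant of the submatrix on \<open>S\<close>, in Leibniz form because a
  submatrix would need an index type of its own.\<close>

definition principal_minor :: "'n set \<Rightarrow> real^'n^'n::finite \<Rightarrow> real" where
  "principal_minor S M = (\<Sum>p | p permutes S. of_int (sign p) * (\<Prod>i\<in>S. M $ i $ p i))"

definition minor_sum :: "nat \<Rightarrow> real^'n^'n::finite \<Rightarrow> real" where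
  "minor_sum j M = (\<Sum>S | card S = j. principal_minor S M)"

definition diag_mat :: "('n \<Rightarrow> real) \<Rightarrow> real^'n^'n::finite" where
  "diag_mat d = (\<chi> i j. if i = j then d i else 0)"

lemma det_eq_principal_minor: "det M = principal_minor UNIV M"
  by (simp add: det_def principal_minor_def)

lemma principal_minor_empty [simp]: "principal_minor {} M = 1"
  by (simp add: principal_minor_def)

lemma principal_minor_singleton [simp]: "principal_minor {i} M = M $ i $ i"
  by (simp add: principal_minor_def permutes_sing)

lemma principal_minor_smult: "principal_minor S (c *\<^sub>R M) = c ^ card S * principal_minor S M"
  by (simp add: principal_minor_def prod.distrib sum_distrib_left mult_ac)

text \<open>Multiplying out the Leibniz products, \<open>U\<close> collects the rows where the entry
  of \<open>N\<close> is taken. On \<open>S - U\<close> the diagonal factor vanishes unless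
  \<open>p\<close> fixes the index, so only the permutations of \<open>U\<close> survive.\<close>

lemma principal_minor_add_diag:
  "principal_minor S (diag_mat d + N) = (\<Sum>U\<in>Pow S. principal_minor U N * (\<Prod>i\<in>S - U. d i))"
proof -
  let ?D = "\<lambda>p i. if i = p i then d i else 0"
  have "principal_minor S (diag_mat d + N)
      = (\<Sum>p | p permutes S. \<Sum>U\<in>Pow S. of_int (sign p) * (\<Prod>i\<in>U. N $ i $ p i) * (\<Prod>i\<in>S - U. ?D p i))"
    unfolding principal_minor_def diag_mat_def
    by (simp add: prod_add add.commute[of "if _ then _ else _"] sum_distrib_left mult.assoc)
  also have "\<dots> = (\<Sum>U\<in>Pow S. \<Sum>p | p permutes S.
      of_int (sign p) * (\<Prod>i\<in>U. N $ i $ p i) * (\<Prod>i\<in>S - U. ?D p i))"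
    by (rule sum.swap)
  also have "\<dots> = (\<Sum>U\<in>Pow S. principal_minor U N * (\<Prod>i\<in>S - U. d i))"
  proof (rule sum.cong)
    fix U assume U: "U \<in> Pow S"
    have "(\<Sum>p | p permutes S. of_int (sign p) * (\<Prod>i\<in>U. N $ i $ p i) * (\<Prod>i\<in>S - U. ?D p i))
        = (\<Sum>p | p permutes U. of_int (sign p) * (\<Prod>i\<in>U. N $ i $ p i) * (\<Prod>i\<in>S - U. ?D p i))"
    proof (rule sum.mono_neutral_right)
      show "{p. p permutes U} \<subseteq> {p. p permutes S}"
        using U by (auto intro: permutes_subset)
      show "\<forall>p\<in>{p. p permutes S} - {p. p permutes U}.
          of_int (sign p) * (\<Prod>i\<in>U. N $ i $ p i) * (\<Prod>i\<in>S - U. ?D p i) = 0"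
      proof
        fix p assume p: "p \<in> {p. p permutes S} - {p. p permutes U}"
        then obtain i where "i \<in> S - U" "p i \<noteq> i" using permutes_superset[of p S U] by blast
        then have "(\<Prod>i\<in>S - U. ?D p i) = 0" by (intro prod_zero bexI[of _ i]) auto
        then show "of_int (sign p) * (\<Prod>i\<in>U. N $ i $ p i) * (\<Prod>i\<in>S - U. ?D p i) = 0" by simp
      qed
    qed auto
    also have "\<dots> = (\<Sum>p | p permutes U. of_int (sign p) * (\<Prod>i\<in>U. N $ i $ p i) * (\<Prod>i\<in>S - U. d i))"
    proof (rule sum.cong[OF refl])
      fix p assume "p \<in> {p. p permutes U}"
      then have "p i = i" if "i \<in> S - U" for i using that by (auto simp: permutes_not_in)
      then have "(\<Prod>i\<in>S - U. ?D p i) = (\<Prod>i\<in>S - U. d i)" by (intro prod.cong) auto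
      then show "of_int (sign p) * (\<Prod>i\<in>U. N $ i $ p i) * (\<Prod>i\<in>S - U. ?D p i)
          = of_int (sign p) * (\<Prod>i\<in>U. N $ i $ p i) * (\<Prod>i\<in>S - U. d i)" by simp
    qed
    finally show "(\<Sum>p | p permutes S. of_int (sign p) * (\<Prod>i\<in>U. N $ i $ p i) * (\<Prod>i\<in>S - U. ?D p i))
        = principal_minor U N * (\<Prod>i\<in>S - U. d i)"
      by (simp add: principal_minor_def sum_distrib_right)
  qed simp
  finally show ?thesis .
qed

lemma principal_minor_diag:
  fixes d :: "'n::finite \<Rightarrow> real"
  shows "principal_minor S (diag_mat d) = (\<Prod>i\<in>S. d i)"
proof -
  have "principal_minor U (0 :: real^'n^'n) = (if U = {} then 1 else 0)" for U :: "'n set"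
    using principal_minor_smult[of U 0 0] by (cases "U = {}") (auto simp: power_0_left card_eq_0_iff)
  then have "principal_minor S (diag_mat d + 0) = (\<Sum>U\<in>Pow S. if U = {} then \<Prod>i\<in>S - U. d i else 0)"
    unfolding principal_minor_add_diag by (intro sum.cong) auto
  then show ?thesis by (simp add: sum.delta)
qed

lemma minor_sum_diag: "minor_sum j (diag_mat d) = esym j UNIV d"
  by (simp add: minor_sum_def esym_def principal_minor_diag)

section \<open>The characteristic polynomial and its link to \<open>sigma\<close>\<close>

lemma det_char_expansion:
  fixes M :: "real^'n^'n::finite"
  shows "det (mat x - M) = (\<Sum>l\<le>CARD('n). ((-1) ^ (CARD('n) - l) * minor_sum (CARD('n) - l) M) * x ^ l)"
proof -
  have 1: "mat x - M = diag_mat (\<lambda>_. x) + (-1) *\<^sub>R M"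
    by (simp add: vec_eq_iff mat_def diag_mat_def)
  have "det (mat x - M) = (\<Sum>U\<in>UNIV. (-1) ^ card U * principal_minor U M * x ^ (CARD('n) - card U))"
    unfolding 1 det_eq_principal_minor principal_minor_add_diag principal_minor_smult
    by (simp add: card_Diff_subset mult_ac)
  also have "\<dots> = (\<Sum>j\<le>CARD('n). \<Sum>U | U \<in> UNIV \<and> card U = j.
      (-1) ^ card U * principal_minor U M * x ^ (CARD('n) - card U))"
    by (rule sum.group[symmetric]) (auto intro: card_mono)
  also have "\<dots> = (\<Sum>j\<le>CARD('n). (-1) ^ j * minor_sum j M * x ^ (CARD('n) - j))"
    by (intro sum.cong) (auto simp: minor_sum_def sum_distrib_left sum_distrib_right)
  also have "\<dots> = (\<Sum>l\<le>CARD('n). (-1) ^ (CARD('n) - l) * minor_sum (CARD('n) - l) M * x ^ l)"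
    by (rule sum.reindex_bij_witness[of _ "\<lambda>l. CARD('n) - l" "\<lambda>l. CARD('n) - l"]) auto
  finally show ?thesis .
qed

text \<open>A real polynomial function determines its coefficients; for \<open>j\<close> above the
  dimension both sums are empty. Conjugation invariance and the link with eigenvalues both come from
  here.\<close>

lemma minor_sum_eqI:
  fixes M N :: "real^'n^'n::finite"
  assumes "\<And>x. det (mat x - M) = det (mat x - N)"
  shows "minor_sum j M = minor_sum j N"
proof (cases "j \<le> CARD('n)")
  case True
  have "\<forall>l\<le>CARD('n). (-1) ^ (CARD('n) - l) * minor_sum (CARD('n) - l) M
      = (-1) ^ (CARD('n) - l) * minor_sum (CARD('n) - l) N"
    using assms unfolding det_char_expansion by (subst polyfun_eq_coeffs[symmetric]) blast
  from this[rule_format, of "CARD('n) - j"] show ?thesis using True by simp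
next
  case False
  then have "{S :: 'n set. card S = j} = {}"
    using card_mono[of "UNIV :: 'n set"] by fastforce
  then show ?thesis by (simp add: minor_sum_def)
qed

lemma det_char_orthogonal_conj:
  fixes M Q :: "real^'n^'n::finite"
  assumes Q: "orthogonal_matrix Q"
  shows "det (mat x - transpose Q ** M ** Q) = det (mat x - M)"
proof -
  have QQ: "transpose Q ** Q = mat 1" using Q by (simp add: orthogonal_matrix_def)
  have "mat x - transpose Q ** M ** Q = transpose Q ** (mat x - M) ** Q"
  proof -
    have "transpose Q ** mat x ** Q = mat x"
    proof -
      have m: "mat x = x *\<^sub>R (mat 1 :: real^'n^'n)" by (simp add: vec_eq_iff mat_def)
      show ?thesis unfolding m using QQ
        by (simp add: matrix_scalar_ac flip: scalar_matrix_assoc)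
    qed
    moreover have "transpose Q ** (mat x - M) ** Q = transpose Q ** mat x ** Q - transpose Q ** M ** Q"
      by (simp add: vec_eq_iff matrix_matrix_mult_def algebra_simps sum_subtractf)
    ultimately show ?thesis by simp
  qed
  then have "det (mat x - transpose Q ** M ** Q) = det (transpose Q ** Q) * det (mat x - M)"
    by (simp add: det_mul)
  then show ?thesis using QQ by simp
qed

lemma minor_sum_orthogonal_conj:
  "orthogonal_matrix Q \<Longrightarrow> minor_sum j (transpose Q ** M ** Q) = minor_sum j M"
  by (intro minor_sum_eqI det_char_orthogonal_conj)

text \<open>The choice in \<open>eigenvalues\<close> has its property only once some splitting of
  the characteristic polynomial is known; \<open>d\<close> is that witness. Whichever splitting is
  chosen, the characteristic polynomial, and with it the minor sums, is the same.\<close>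

lemma sigma_eq_minor_sum:
  fixes M :: "real^'n^'n::finite" and d :: "'n \<Rightarrow> real"
  assumes "\<And>x. det (mat x - M) = det (mat x - diag_mat d)"
  shows "sigma j M = minor_sum j M"
proof -
  have char: "det (mat x - diag_mat e) = (\<Prod>i\<in>UNIV. x - e i)" for x and e :: "'n \<Rightarrow> real"
  proof -
    have "mat x - diag_mat e = diag_mat (\<lambda>i. x - e i)" by (simp add: vec_eq_iff mat_def diag_mat_def)
    then show ?thesis by (simp add: det_eq_principal_minor principal_minor_diag)
  qed
  let ?P = "\<lambda>\<mu> :: real^'n. \<forall>x. det (mat x - M) = (\<Prod>i\<in>UNIV. x - \<mu> $ i)"
  have "?P (\<chi> i. d i)" using assms char by simp
  then have "?P (eigenvalues M)" unfolding eigenvalues_def by (rule someI)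
  then have "det (mat x - M) = det (mat x - diag_mat (($) (eigenvalues M)))" for x
    using char by simp
  then have "minor_sum j M = esym j UNIV (($) (eigenvalues M))"
    unfolding minor_sum_diag[symmetric] by (rule minor_sum_eqI)
  then show ?thesis by (simp add: sigma_def elem_sym_def esym_def)
qed

lemma minor_sum_0 [simp]:
  fixes M :: "real^'n^'n::finite"
  shows "minor_sum 0 M = 1"
proof -
  have "{S :: 'n set. card S = 0} = {{}}" by (auto simp: card_eq_0_iff)
  then show ?thesis by (simp add: minor_sum_def)
qed

text \<open>A Taylor expansion at a diagonal matrix: the sets \<open>U\<close> of size 0, 1 and at
  least 2 give the constant term, the differential and the remainder.\<close>

lemma minor_sum_add_diag:
  fixes N :: "real^'n^'n::finite"
  shows "minor_sum (Suc j) (diag_mat d + N) = esym (Suc j) UNIV d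
      + (\<Sum>i\<in>UNIV. N $ i $ i * esym j (UNIV - {i}) d)
      + (\<Sum>S | card S = Suc j. \<Sum>U | U \<subseteq> S \<and> 2 \<le> card U. principal_minor U N * (\<Prod>i\<in>S - U. d i))"
proof -
  let ?t = "\<lambda>S U. principal_minor U N * (\<Prod>i\<in>S - U. d i)"
  have 1: "(\<Sum>U\<in>Pow S. ?t S U) = (\<Prod>i\<in>S. d i) + (\<Sum>i\<in>S. N $ i $ i * (\<Prod>l\<in>S - {i}. d l))
      + (\<Sum>U | U \<subseteq> S \<and> 2 \<le> card U. ?t S U)" for S
  proof -
    have P: "Pow S = {{}} \<union> ((\<lambda>i. {i}) ` S) \<union> {U. U \<subseteq> S \<and> 2 \<le> card U}"
    proof (intro equalityI subsetI)
      fix U assume U: "U \<in> Pow S"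
      consider "card U = 0" | "card U = 1" | "2 \<le> card U" by linarith
      then show "U \<in> {{}} \<union> ((\<lambda>i. {i}) ` S) \<union> {U. U \<subseteq> S \<and> 2 \<le> card U}"
        using U by cases (auto simp: card_1_singleton_iff)
    qed auto
    have "sum (?t S) (Pow S) = sum (?t S) ({{}} \<union> ((\<lambda>i. {i}) ` S)) + sum (?t S) {U. U \<subseteq> S \<and> 2 \<le> card U}"
      by (subst P, rule sum.union_disjoint) auto
    also have "sum (?t S) ({{}} \<union> ((\<lambda>i. {i}) ` S)) = ?t S {} + sum (?t S) ((\<lambda>i. {i}) ` S)"
      by (subst sum.union_disjoint) auto
    also have "sum (?t S) ((\<lambda>i. {i}) ` S) = (\<Sum>i\<in>S. N $ i $ i * (\<Prod>l\<in>S - {i}. d l))"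
      by (subst sum.reindex) (auto simp: inj_on_def)
    finally show ?thesis by simp
  qed
  have 2: "(\<Sum>S | card S = Suc j. \<Sum>i\<in>S. N $ i $ i * (\<Prod>l\<in>S - {i}. d l))
      = (\<Sum>i\<in>UNIV. N $ i $ i * esym j (UNIV - {i}) d)"
  proof -
    have "(\<Sum>S | card S = Suc j. \<Sum>i\<in>S. N $ i $ i * (\<Prod>l\<in>S - {i}. d l))
       = (\<Sum>S | card S = Suc j. \<Sum>i | i \<in> UNIV \<and> i \<in> S. N $ i $ i * (\<Prod>l\<in>S - {i}. d l))"
      by simp
    also have "\<dots> = (\<Sum>i\<in>UNIV. \<Sum>S | S \<in> {S. card S = Suc j} \<and> i \<in> S. N $ i $ i * (\<Prod>l\<in>S - {i}. d l))"
      by (rule sum.swap_restrict) auto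
    also have "\<dots> = (\<Sum>i\<in>UNIV. \<Sum>R | R \<subseteq> UNIV - {i} \<and> card R = j. N $ i $ i * (\<Prod>l\<in>R. d l))"
    proof (rule sum.cong[OF refl])
      fix i
      show "(\<Sum>S | S \<in> {S. card S = Suc j} \<and> i \<in> S. N $ i $ i * (\<Prod>l\<in>S - {i}. d l))
          = (\<Sum>R | R \<subseteq> UNIV - {i} \<and> card R = j. N $ i $ i * (\<Prod>l\<in>R. d l))"
        by (rule sum.reindex_bij_witness[of _ "insert i" "\<lambda>S. S - {i}"]) (auto simp: insert_absorb card_insert_if)
    qed
    finally show ?thesis by (simp add: esym_def sum_distrib_left)
  qed
  show ?thesis
    unfolding minor_sum_def principal_minor_add_diag 1 sum.distrib 2 by (simp add: esym_def)
qed

text \<open>Every permutation of \<open>S\<close> yields the same product, so the minor is a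
  multiple of the sum of all signs, and composing with a transposition of two elements of
  \<open>S\<close> shows that this sum is its own negative.\<close>

lemma principal_minor_rank_one:
  assumes "2 \<le> card S"
  shows "principal_minor S (\<chi> i j. c * \<eta> i * \<eta> j) = 0"
proof -
  obtain a b where ab: "a \<in> S" "b \<in> S" "a \<noteq> b"
    using assms card_le_Suc0_iff_eq[of S] by force
  let ?q = "Transposition.transpose a b"
  have q: "?q permutes S" by (rule permutes_swap_id[OF ab(1,2)])
  let ?F = "\<lambda>p. real_of_int (sign p)"
  have "sum ?F {p. p permutes S} = (\<Sum>p | p permutes S. ?F (?q \<circ> p))"
    by (rule setum_permutations_compose_left[OF q])
  also have "\<dots> = (\<Sum>p | p permutes S. - ?F p)"
  proof (rule sum.cong[OF refl])
    fix p assume "p \<in> {p. p permutes S}"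
    then have "permutation p" using permutation_permutes[of p] by auto
    then show "?F (?q \<circ> p) = - ?F p"
      using ab by (simp add: sign_compose permutation_swap_id sign_swap_id)
  qed
  finally have zero: "sum ?F {p. p permutes S} = 0" by (simp add: sum_negf)
  have "principal_minor S (\<chi> i j. c * \<eta> i * \<eta> j) = (\<Sum>p | p permutes S. ?F p * (\<Prod>i\<in>S. c * \<eta> i * \<eta> i))"
    unfolding principal_minor_def
  proof (rule sum.cong[OF refl])
    fix p assume "p \<in> {p. p permutes S}"
    then have "(\<Prod>i\<in>S. \<eta> (p i)) = (\<Prod>i\<in>S. \<eta> i)" by (auto intro: prod.permute[symmetric, unfolded comp_def])
    then show "?F p * (\<Prod>i\<in>S. (\<chi> i j. c * \<eta> i * \<eta> j) $ i $ p i) = ?F p * (\<Prod>i\<in>S. c * \<eta> i * \<eta> i)"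
      by (simp add: prod.distrib)
  qed
  then show ?thesis using zero by (simp flip: sum_distrib_right)
qed

text \<open>The remainder vanishes for rank one, so the dependence on \<open>c\<close> is exactly
  affine, with the coefficients whose positivity \<open>esym_remove_pos\<close> provides.\<close>

lemma minor_sum_diag_rank_one:
  "minor_sum (Suc j) (diag_mat d + (\<chi> i j. c * \<eta> i * \<eta> j)) = esym (Suc j) UNIV d
      + c * (\<Sum>i\<in>UNIV. (\<eta> i)\<^sup>2 * esym j (UNIV - {i}) d)"
  unfolding minor_sum_add_diag
  using principal_minor_rank_one[of _ c \<eta>]
  by (simp add: sum_distrib_left power2_eq_square mult.assoc mult.left_commute)

section \<open>Perturbation of a diagonal matrix with entries 0 and 1\<close>

lemma esym_indicator:
  fixes A T :: "'a::finite set"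
  shows "esym j A (\<lambda>i. if i \<in> T then 1 else 0) = real (card (A \<inter> T) choose j)"
proof -
  have "(\<Prod>i\<in>S. if i \<in> T then 1 else 0 :: real) = (if S \<subseteq> T then 1 else 0)" for S
    by (cases "S \<subseteq> T") (auto intro!: prod.neutral prod_zero)
  then have "esym j A (\<lambda>i. if i \<in> T then 1 else 0)
      = (\<Sum>S | S \<subseteq> A \<and> card S = j. if S \<subseteq> T then 1 else 0)"
    by (simp add: esym_def)
  also have "\<dots> = real (card {S \<in> {S. S \<subseteq> A \<and> card S = j}. S \<subseteq> T})"
    by (subst sum.inter_filter[symmetric]) auto
  also have "{S \<in> {S. S \<subseteq> A \<and> card S = j}. S \<subseteq> T} = {S. S \<subseteq> A \<inter> T \<and> card S = j}"
    by auto
  also have "card \<dots> = card (A \<inter> T) choose j" by (rule n_subsets) simp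
  finally show ?thesis .
qed

text \<open>A crude bound independent of \<open>U\<close>; \<open>1 \<le> C\<close> permits raising
  the exponent from \<open>card U\<close> to the dimension.\<close>

lemma principal_minor_bound:
  fixes A :: "real^'n^'n::finite"
  assumes "\<And>i j. \<bar>A $ i $ j\<bar> \<le> C" "1 \<le> C"
  shows "\<bar>principal_minor U A\<bar> \<le> fact CARD('n) * C ^ CARD('n)"
proof -
  have "\<bar>principal_minor U A\<bar> \<le> (\<Sum>p | p permutes U. C ^ CARD('n))"
    unfolding principal_minor_def
  proof (rule order_trans[OF sum_abs sum_mono])
    fix p
    have "\<bar>of_int (sign p) * (\<Prod>i\<in>U. A $ i $ p i)\<bar> = (\<Prod>i\<in>U. \<bar>A $ i $ p i\<bar>)"
      by (simp add: abs_mult abs_prod sign_def)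
    also have "\<dots> \<le> (\<Prod>i\<in>U. C)" by (intro prod_mono) (use assms in auto)
    also have "\<dots> \<le> C ^ CARD('n)" using assms(2) by (simp add: power_increasing card_mono)
    finally show "\<bar>of_int (sign p) * (\<Prod>i\<in>U. A $ i $ p i)\<bar> \<le> C ^ CARD('n)" .
  qed
  also have "\<dots> = fact (card U) * C ^ CARD('n)" by (simp add: card_permutations)
  also have "\<dots> \<le> fact CARD('n) * C ^ CARD('n)"
    using assms(2) by (intro mult_right_mono) (auto intro!: fact_mono card_mono)
  finally show ?thesis .
qed

text \<open>With only \<open>m\<close> ones on the diagonal, order \<open>m + 1\<close> has no
  constant term. In its differential, removing \<open>i\<close> leaves \<open>m\<close> ones exactly
  when \<open>i \<notin> T\<close>, so just the diagonal entries of \<open>A\<close> outside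
  \<open>T\<close> count. Orders up to \<open>m\<close> start from a binomial coefficient that is at
  least 1. \<open>K\<close> is chosen before \<open>A\<close>, which later makes the estimate
  uniform in \<open>x\<close>.\<close>

lemma minor_sum_perturbation:
  fixes T :: "'n::finite set"
  assumes "card T = m" and C: "1 \<le> C"
  obtains K where "0 \<le> K"
    "\<And>A :: real^'n^'n. \<And>\<epsilon>. (\<And>i j. \<bar>A $ i $ j\<bar> \<le> C) \<Longrightarrow> 0 \<le> \<epsilon> \<Longrightarrow> \<epsilon> \<le> 1 \<Longrightarrow>
       \<bar>minor_sum (Suc m) (diag_mat (\<lambda>i. if i \<in> T then 1 else 0) + \<epsilon> *\<^sub>R A)
          - \<epsilon> * (\<Sum>i\<in>- T. A $ i $ i)\<bar> \<le> K * \<epsilon>\<^sup>2"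
    "\<And>A :: real^'n^'n. \<And>\<epsilon> j. (\<And>i j. \<bar>A $ i $ j\<bar> \<le> C) \<Longrightarrow> 0 \<le> \<epsilon> \<Longrightarrow> \<epsilon> \<le> 1 \<Longrightarrow> j \<le> m \<Longrightarrow>
       1 - K * \<epsilon> \<le> minor_sum j (diag_mat (\<lambda>i. if i \<in> T then 1 else 0) + \<epsilon> *\<^sub>R A)"
proof -
  define d :: "'n \<Rightarrow> real" where "d = (\<lambda>i. if i \<in> T then 1 else 0)"
  define B where "B = fact CARD('n) * C ^ CARD('n)"
  \<comment> \<open>\<open>K1\<close> bounds the remainder by counting all pairs of sets
    \<open>S\<close> and \<open>U\<close>; \<open>K2\<close> bounds the differentials of all orders
    up to \<open>m\<close> at once.\<close>
  define K1 where "K1 = (\<Sum>S\<in>(UNIV :: 'n set set). \<Sum>U\<in>(UNIV :: 'n set set). B)"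
  define K2 where "K2 = (\<Sum>j\<le>m. \<Sum>i\<in>(UNIV :: 'n set). C * esym j (UNIV - {i}) d)"
  have B: "B \<ge> 0" using C by (simp add: B_def)
  have K1: "K1 \<ge> 0" unfolding K1_def using B by (intro sum_nonneg) auto
  have esym_nonneg: "0 \<le> esym j X d" for j X unfolding d_def esym_indicator by simp
  have K2: "K2 \<ge> 0" unfolding K2_def using C esym_nonneg by (intro sum_nonneg mult_nonneg_nonneg) auto
  have remainder: "\<bar>\<Sum>S | card S = Suc j. \<Sum>U | U \<subseteq> S \<and> 2 \<le> card U.
      principal_minor U (\<epsilon> *\<^sub>R A) * (\<Prod>i\<in>S - U. d i)\<bar> \<le> K1 * \<epsilon>\<^sup>2"
    if A: "\<And>i j. \<bar>A $ i $ j\<bar> \<le> C" and \<epsilon>: "0 \<le> \<epsilon>" "\<epsilon> \<le> 1" for A :: "real^'n^'n" and \<epsilon> j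
  proof -
    have t: "\<bar>principal_minor U (\<epsilon> *\<^sub>R A) * (\<Prod>i\<in>S - U. d i)\<bar> \<le> \<epsilon>\<^sup>2 * B" if "2 \<le> card U" for S U
    proof -
      have "\<bar>\<Prod>i\<in>S - U. d i\<bar> \<le> 1" unfolding abs_prod by (rule prod_le_1) (auto simp: d_def)
      moreover have "\<epsilon> ^ card U \<le> \<epsilon>\<^sup>2" using that \<epsilon> by (intro power_decreasing) auto
      then have "\<bar>principal_minor U (\<epsilon> *\<^sub>R A)\<bar> \<le> \<epsilon>\<^sup>2 * B"
        unfolding principal_minor_smult abs_mult B_def
        using \<epsilon> principal_minor_bound[of A C U, OF A C] by (intro mult_mono) auto
      ultimately have "\<bar>principal_minor U (\<epsilon> *\<^sub>R A)\<bar> * \<bar>\<Prod>i\<in>S - U. d i\<bar> \<le> \<epsilon>\<^sup>2 * B * 1"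
        using B by (intro mult_mono) auto
      then show ?thesis by (simp add: abs_mult)
    qed
    have "\<bar>\<Sum>S | card S = Suc j. \<Sum>U | U \<subseteq> S \<and> 2 \<le> card U.
      principal_minor U (\<epsilon> *\<^sub>R A) * (\<Prod>i\<in>S - U. d i)\<bar>
      \<le> (\<Sum>S | card (S :: 'n set) = Suc j. \<Sum>U | U \<subseteq> S \<and> 2 \<le> card U. \<epsilon>\<^sup>2 * B)"
    proof (rule order_trans[OF sum_abs sum_mono])
      fix S :: "'n set"
      show "\<bar>\<Sum>U | U \<subseteq> S \<and> 2 \<le> card U. principal_minor U (\<epsilon> *\<^sub>R A) * (\<Prod>i\<in>S - U. d i)\<bar>
          \<le> (\<Sum>U | U \<subseteq> S \<and> 2 \<le> card U. \<epsilon>\<^sup>2 * B)"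
        by (rule order_trans[OF sum_abs sum_mono]) (auto intro: t)
    qed
    also have "\<dots> \<le> (\<Sum>S\<in>(UNIV :: 'n set set). \<Sum>U\<in>(UNIV :: 'n set set). \<epsilon>\<^sup>2 * B)"
    proof (rule order_trans[OF sum_mono sum_mono2])
      fix S :: "'n set"
      show "(\<Sum>U | U \<subseteq> S \<and> 2 \<le> card U. \<epsilon>\<^sup>2 * B) \<le> (\<Sum>U\<in>(UNIV :: 'n set set). \<epsilon>\<^sup>2 * B)"
        using B by (intro sum_mono2) auto
    qed (use B in \<open>auto intro!: sum_nonneg\<close>)
    also have "\<dots> = K1 * \<epsilon>\<^sup>2" by (simp add: K1_def)
    finally show ?thesis .
  qed
  show ?thesis
  proof (rule that[of "K1 + K2"])
    show "0 \<le> K1 + K2" using K1 K2 by simp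
  next
    fix A :: "real^'n^'n" and \<epsilon> :: real
    assume A: "\<And>i j. \<bar>A $ i $ j\<bar> \<le> C" and \<epsilon>: "0 \<le> \<epsilon>" "\<epsilon> \<le> 1"
    have "esym m (UNIV - {i}) d = (if i \<in> T then 0 else 1)" for i
    proof (cases "i \<in> T")
      case True
      then have "card ((UNIV - {i}) \<inter> T) < m" using assms(1)
        by (metis Diff_Int_distrib2 Int_UNIV_left card_Diff1_less finite_code Int_insert_left_if1 inf_bot_left)
      then show ?thesis using True by (simp add: d_def esym_indicator)
    next
      case False
      then have "(UNIV - {i}) \<inter> T = T" by auto
      then show ?thesis using False assms(1) by (simp add: d_def esym_indicator)
    qed
    then have "(\<Sum>i\<in>UNIV. (\<epsilon> *\<^sub>R A) $ i $ i * esym m (UNIV - {i}) d) = (\<Sum>i\<in>- T. \<epsilon> * A $ i $ i)"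
      by (intro sum.mono_neutral_cong_right) auto
    moreover have "esym (Suc m) UNIV d = 0" unfolding d_def esym_indicator using assms(1) by simp
    ultimately have "\<bar>minor_sum (Suc m) (diag_mat d + \<epsilon> *\<^sub>R A) - \<epsilon> * (\<Sum>i\<in>- T. A $ i $ i)\<bar> \<le> K1 * \<epsilon>\<^sup>2"
      unfolding minor_sum_add_diag using remainder[of A \<epsilon> m, OF A \<epsilon>] by (simp add: sum_distrib_left)
    also have "\<dots> \<le> (K1 + K2) * \<epsilon>\<^sup>2" using K2 by (intro mult_right_mono) auto
    finally show "\<bar>minor_sum (Suc m) (diag_mat (\<lambda>i. if i \<in> T then 1 else 0) + \<epsilon> *\<^sub>R A)
          - \<epsilon> * (\<Sum>i\<in>- T. A $ i $ i)\<bar> \<le> (K1 + K2) * \<epsilon>\<^sup>2" unfolding d_def .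
  next
    fix A :: "real^'n^'n" and \<epsilon> :: real and j
    assume A: "\<And>i j. \<bar>A $ i $ j\<bar> \<le> C" and \<epsilon>: "0 \<le> \<epsilon>" "\<epsilon> \<le> 1" and j: "j \<le> m"
    have "1 - (K1 + K2) * \<epsilon> \<le> minor_sum j (diag_mat d + \<epsilon> *\<^sub>R A)"
    proof (cases j)
      case 0
      then show ?thesis using K1 K2 \<epsilon> by simp
    next
      case (Suc l)
      have "1 \<le> esym (Suc l) UNIV d"
        unfolding d_def esym_indicator using assms(1) j Suc by (simp add: Suc_le_eq)
      moreover have "\<bar>\<Sum>i\<in>UNIV. (\<epsilon> *\<^sub>R A) $ i $ i * esym l (UNIV - {i}) d\<bar>
          \<le> (\<Sum>i\<in>UNIV. \<epsilon> * (C * esym l (UNIV - {i}) d))"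
      proof (rule order_trans[OF sum_abs sum_mono])
        fix i
        show "\<bar>(\<epsilon> *\<^sub>R A) $ i $ i * esym l (UNIV - {i}) d\<bar> \<le> \<epsilon> * (C * esym l (UNIV - {i}) d)"
          using A[of i i] \<epsilon> esym_nonneg[of l "UNIV - {i}"]
          by (simp add: abs_mult mult.assoc) (intro mult_left_mono mult_right_mono, auto)
      qed
      moreover have "(\<Sum>i\<in>UNIV. C * esym l (UNIV - {i}) d) \<le> K2"
        unfolding K2_def
        by (rule member_le_sum[of l "{..m}" "\<lambda>j. \<Sum>i\<in>UNIV. C * esym j (UNIV - {i}) d"])
           (use j Suc C esym_nonneg in \<open>auto intro!: sum_nonneg mult_nonneg_nonneg\<close>)
      then have "(\<Sum>i\<in>UNIV. \<epsilon> * (C * esym l (UNIV - {i}) d)) \<le> \<epsilon> * K2"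
        unfolding sum_distrib_left[symmetric] using \<epsilon> by (intro mult_left_mono)
      moreover have "K1 * \<epsilon>\<^sup>2 \<le> K1 * \<epsilon>"
        using \<epsilon> K1 by (intro mult_left_mono) (auto simp: power2_eq_square mult_left_le)
      ultimately show ?thesis
        unfolding Suc minor_sum_add_diag using remainder[of A \<epsilon> l, OF A \<epsilon>]
        by (simp add: algebra_simps)
    qed
    then show "1 - (K1 + K2) * \<epsilon> \<le> minor_sum j (diag_mat (\<lambda>i. if i \<in> T then 1 else 0) + \<epsilon> *\<^sub>R A)"
      unfolding d_def .
  qed
qed

section \<open>Diagonalization of symmetric matrices\<close>

text \<open>A maximizer \<open>v\<close> of the quadratic form on the unit sphere of
  \<open>W\<close> is critical: \<open>f v - c v\<close> is orthogonal to \<open>W\<close>. By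
  invariance it also lies in \<open>W\<close>, so it is zero.\<close>

lemma selfadjoint_eigenvector:
  fixes f :: "'a::euclidean_space \<Rightarrow> 'a"
  assumes lin: "linear f" and sa: "\<And>x y. f x \<bullet> y = x \<bullet> f y"
    and W: "subspace W" "f ` W \<subseteq> W" "W \<noteq> {0}"
  obtains v c where "v \<in> W" "norm v = 1" "f v = c *\<^sub>R v"
proof -
  let ?S = "W \<inter> sphere 0 1"
  have "compact ?S" using closed_subspace[OF W(1)] by (intro closed_Int_compact) auto
  moreover have "?S \<noteq> {}"
  proof -
    obtain x where "x \<in> W" "x \<noteq> 0" using W subspace_0 by blast
    then have "inverse (norm x) *\<^sub>R x \<in> ?S" using W(1) by (auto simp: subspace_scale)
    then show ?thesis by blast
  qed
  moreover have "continuous_on ?S (\<lambda>x. f x \<bullet> x)"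
    using lin by (intro continuous_intros linear_continuous_on) (auto simp: linear_conv_bounded_linear)
  ultimately obtain v where v: "v \<in> ?S" and max: "\<And>x. x \<in> ?S \<Longrightarrow> f x \<bullet> x \<le> f v \<bullet> v"
    using continuous_attains_sup[of ?S] by blast
  define c where "c = f v \<bullet> v"
  have quad: "f x \<bullet> x \<le> c * (x \<bullet> x)" if "x \<in> W" for x
  proof (cases "x = 0")
    case True
    then show ?thesis using lin by (simp add: linear_0)
  next
    case False
    let ?y = "inverse (norm x) *\<^sub>R x"
    have "?y \<in> ?S" using that False W(1) by (auto simp: subspace_scale)
    from max[OF this] have "(f x \<bullet> x) / (norm x)\<^sup>2 \<le> c"
      using lin by (simp add: linear_scale c_def power2_eq_square divide_inverse mult_ac)
    then show ?thesis using False by (simp add: divide_le_eq dot_square_norm)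
  qed
  have ortho: "(f v - c *\<^sub>R v) \<bullet> w = 0" if w: "w \<in> W" for w
  proof (rule ccontr)
    assume nz: "(f v - c *\<^sub>R v) \<bullet> w \<noteq> 0"
    define a where "a = (f v - c *\<^sub>R v) \<bullet> w"
    define b where "b = c * (w \<bullet> w) - f w \<bullet> w"
    have ineq: "2 * s * a \<le> s\<^sup>2 * b" for s
    proof -
      have "v + s *\<^sub>R w \<in> W" using v w W(1) by (auto intro: subspace_add subspace_scale)
      from quad[OF this] have "(f v + s *\<^sub>R f w) \<bullet> (v + s *\<^sub>R w) \<le> c * ((v + s *\<^sub>R w) \<bullet> (v + s *\<^sub>R w))"
        using lin by (simp add: linear_add linear_scale)
      moreover have "f w \<bullet> v = f v \<bullet> w" using sa by (simp add: inner_commute)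
      moreover have "v \<bullet> v = 1" using v by (simp add: dot_square_norm)
      ultimately show ?thesis
        by (simp add: a_def b_def inner_add_left inner_add_right inner_diff_left inner_commute[of w v]
            power2_eq_square algebra_simps c_def)
    qed
    have b: "0 \<le> b" using quad[OF w] by (simp add: b_def)
    \<comment> \<open>The minimizer of \<open>s\<^sup>2 (b + 1) - 2 s a\<close>; the added 1 keeps
      the denominator positive when \<open>b = 0\<close>.\<close>
    define s where "s = a / (b + 1)"
    have "2 * a\<^sup>2 / (b + 1) \<le> (a / (b + 1))\<^sup>2 * b"
      using ineq[of s] by (simp add: s_def power2_eq_square)
    also have "\<dots> = a\<^sup>2 / (b + 1) * (b / (b + 1))" by (simp add: power2_eq_square)
    also have "\<dots> \<le> a\<^sup>2 / (b + 1) * 1" using b by (intro mult_left_mono) auto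
    finally have "a\<^sup>2 / (b + 1) \<le> 0" by simp
    moreover have "a\<^sup>2 / (b + 1) > 0" using nz b by (simp add: a_def)
    ultimately show False by simp
  qed
  have "f v - c *\<^sub>R v \<in> W" using v W by (auto intro: subspace_diff subspace_scale)
  from ortho[OF this] have "f v = c *\<^sub>R v" by simp
  then show ?thesis using that v by auto
qed

text \<open>An orthonormal family of eigenvectors of greatest size must span: its orthogonal
  complement is invariant and, if nonzero, would contain a further eigenvector.\<close>

lemma selfadjoint_orthonormal_eigenbasis:
  fixes f :: "'a::euclidean_space \<Rightarrow> 'a"
  assumes lin: "linear f" and sa: "\<And>x y. f x \<bullet> y = x \<bullet> f y"
  obtains B where "pairwise orthogonal B" "card B = DIM('a)" "finite B"
    "\<And>b. b \<in> B \<Longrightarrow> norm b = 1" "\<And>b. b \<in> B \<Longrightarrow> \<exists>c. f b = c *\<^sub>R b"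
proof -
  let ?P = "\<lambda>B. pairwise orthogonal B \<and> (\<forall>b\<in>B. norm b = 1 \<and> (\<exists>c. f b = c *\<^sub>R b))"
  have indep: "independent B" if "?P B" for B
    using that by (intro pairwise_orthogonal_independent) auto
  have "\<exists>B. ?P B \<and> (\<forall>B'. ?P B' \<longrightarrow> card B' \<le> card B)"
  proof (rule ex_has_greatest_nat[of ?P "{}" card "Suc (DIM('a))"])
    show "\<forall>B. ?P B \<longrightarrow> card B < Suc (DIM('a))"
      using indep independent_card_le by (metis le_imp_less_Suc)
  qed simp
  then obtain B where B: "?P B" and max: "\<And>B'. ?P B' \<Longrightarrow> card B' \<le> card B" by blast
  have fin: "finite B" using indep[OF B] independent_bound by blast
  define W where "W = {x. \<forall>b\<in>B. orthogonal b x}"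
  have sub: "subspace W"
    unfolding W_def subspace_def by (auto simp: orthogonal_def inner_add_right)
  have inv: "f ` W \<subseteq> W"
  proof safe
    fix x assume x: "x \<in> W"
    show "f x \<in> W" unfolding W_def
    proof safe
      fix b assume b: "b \<in> B"
      then obtain c where "f b = c *\<^sub>R b" using B by blast
      then have "b \<bullet> f x = c * (b \<bullet> x)" using sa[of b x] by simp
      then show "orthogonal b (f x)" using x b by (auto simp: W_def orthogonal_def)
    qed
  qed
  have "W = {0}"
  proof (rule ccontr)
    assume "W \<noteq> {0}"
    from selfadjoint_eigenvector[OF lin sa sub inv this]
    obtain v c where v: "v \<in> W" "norm v = 1" "f v = c *\<^sub>R v" by blast
    have "v \<notin> B"
    proof
      assume "v \<in> B"
      then have "v \<bullet> v = 0" using v(1) by (auto simp: W_def orthogonal_def)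
      then show False using v(2) by simp
    qed
    moreover have "?P (insert v B)"
      using B v by (auto simp: pairwise_insert W_def orthogonal_commute)
    ultimately show False using max[of "insert v B"] fin by simp
  qed
  moreover have "x \<in> span B" for x
  proof -
    obtain y z where yz: "y \<in> span B" "\<And>w. w \<in> span B \<Longrightarrow> orthogonal z w" "x = y + z"
      using orthogonal_subspace_decomp_exists[of B x] by blast
    then have "z \<in> W" by (auto simp: W_def orthogonal_commute span_base)
    then show ?thesis using yz \<open>W = {0}\<close> by simp
  qed
  then have "span B = UNIV" by auto
  then have "card B = DIM('a)" using indep[OF B] dim_eq_card[of B UNIV] by simp
  then show ?thesis using that B fin by blast
qed

lemma conj_entry:
  fixes M Q :: "real^'n^'n::finite"
  shows "(transpose Q ** M ** Q) $ i $ j = column i Q \<bullet> (M *v column j Q)"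
  unfolding matrix_mul_assoc[symmetric]
  by (simp add: matrix_matrix_mult_def matrix_vector_mult_def transpose_def column_def inner_vec_def)

lemma column_inner:
  fixes Q :: "real^'n^'n::finite"
  shows "orthogonal_matrix Q \<Longrightarrow> column i Q \<bullet> column j Q = (if i = j then 1 else 0)"
  unfolding orthogonal_matrix_orthonormal_columns orthogonal_def norm_eq_1 by simp

lemma symmetric_inner:
  fixes M :: "real^'n^'n::finite"
  assumes "transpose M = M"
  shows "(M *v x) \<bullet> y = x \<bullet> (M *v y)"
  using assms by (metis dot_lmul_matrix inner_commute transpose_matrix_vector)

lemma symmetric_matrix_diagonalization:
  fixes M :: "real^'n^'n::finite"
  assumes "transpose M = M"
  obtains Q d where "orthogonal_matrix Q" "transpose Q ** M ** Q = diag_mat d"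
    "\<And>i. M *v column i Q = d i *\<^sub>R column i Q"
proof -
  have "linear ((*v) M)" by simp
  from selfadjoint_orthonormal_eigenbasis[OF this symmetric_inner[OF assms]]
  obtain B where B: "pairwise orthogonal B" "card B = CARD('n)" "finite B"
    "\<And>b. b \<in> B \<Longrightarrow> norm b = 1" "\<And>b. b \<in> B \<Longrightarrow> \<exists>c. M *v b = c *\<^sub>R b" by auto
  obtain q where q: "bij_betw q (UNIV :: 'n set) B"
    using finite_same_card_bij[of "UNIV :: 'n set" B] B by auto
  then have qB: "q i \<in> B" for i by (auto simp: bij_betw_def)
  then have "\<forall>i. \<exists>c. M *v q i = c *\<^sub>R q i" using B(5) by blast
  then obtain d where d: "\<And>i. M *v q i = d i *\<^sub>R q i" by metis
  define Q :: "real^'n^'n" where "Q = (\<chi> i j. q j $ i)"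
  have col: "column i Q = q i" for i by (simp add: Q_def column_def vec_eq_iff)
  have "inj q" using q by (simp add: bij_betw_def)
  then have Q: "orthogonal_matrix Q"
    using B(1,4) qB unfolding orthogonal_matrix_orthonormal_columns col
    by (auto simp: pairwise_def inj_eq)
  have "(transpose Q ** M ** Q) $ i $ j = diag_mat d $ i $ j" for i j
    using column_inner[OF Q, of i j] unfolding conj_entry col d by (simp add: diag_mat_def)
  then have "transpose Q ** M ** Q = diag_mat d" by (simp add: vec_eq_iff)
  then show ?thesis using that Q d by (simp add: col)
qed

lemma sigma_symmetric:
  fixes M :: "real^'n^'n::finite"
  assumes "transpose M = M"
  shows "sigma j M = minor_sum j M"
proof -
  obtain Q d where "orthogonal_matrix Q" "transpose Q ** M ** Q = diag_mat d"
    using symmetric_matrix_diagonalization[OF assms] by metis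
  then show ?thesis
    using sigma_eq_minor_sum[of M d j] det_char_orthogonal_conj[of Q _ M] by metis
qed

section \<open>Monotonicity of the Hessian operators on the cone\<close>

definition outer :: "real^'n \<Rightarrow> real^'n^'n::finite" where
  "outer \<xi> = (\<chi> i j. \<xi> $ i * \<xi> $ j)"

lemma outer_mult: "outer \<xi> *v x = (\<xi> \<bullet> x) *\<^sub>R \<xi>"
  by (simp add: outer_def matrix_vector_mult_def inner_vec_def vec_eq_iff sum_distrib_left mult_ac)

lemma transpose_outer: "transpose (outer \<xi>) = outer \<xi>"
  by (simp add: outer_def transpose_def vec_eq_iff mult.commute)

lemma minor_sum_rank_one_mono:
  fixes A :: "real^'n^'n::finite"
  assumes A: "transpose A = A" and c: "0 \<le> c"
    and pos: "\<And>j. j \<le> k \<Longrightarrow> 0 < minor_sum j A" and j: "j \<le> k"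
  shows "minor_sum j A \<le> minor_sum j (A + c *\<^sub>R outer \<xi>)"
proof (cases j)
  case (Suc l)
  obtain Q d where Q: "orthogonal_matrix Q" and d: "transpose Q ** A ** Q = diag_mat d"
    using symmetric_matrix_diagonalization[OF A] by metis
  define \<eta> where "\<eta> = (\<lambda>i. column i Q \<bullet> \<xi>)"
  have "transpose Q ** (A + c *\<^sub>R outer \<xi>) ** Q = diag_mat d + (\<chi> i j. c * \<eta> i * \<eta> j)"
    unfolding d[symmetric]
    by (simp add: vec_eq_iff conj_entry matrix_vector_mult_add_rdistrib inner_add_right outer_mult \<eta>_def
        inner_commute scaleR_matrix_vector_assoc[symmetric])
  then have upd: "minor_sum j (A + c *\<^sub>R outer \<xi>) = minor_sum j (diag_mat d + (\<chi> i j. c * \<eta> i * \<eta> j))"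
    using minor_sum_orthogonal_conj[OF Q] by metis
  have e: "minor_sum l A = esym l UNIV d" for l
    using minor_sum_orthogonal_conj[OF Q, of l A] d by (simp add: minor_sum_diag)
  have "0 < esym l (UNIV - {i}) d" for i
  proof (rule esym_remove_pos)
    show "0 < esym l (insert i (UNIV - {i})) d" if "l \<le> k" for l
      using pos[OF that] e by (simp add: insert_absorb insert_UNIV)
  qed (use j Suc in auto)
  then have "0 \<le> c * (\<Sum>i\<in>UNIV. (\<eta> i)\<^sup>2 * esym l (UNIV - {i}) d)"
    using c by (intro mult_nonneg_nonneg sum_nonneg) (auto simp: less_imp_le)
  then show ?thesis using upd e[of j] minor_sum_diag_rank_one[of l d c \<eta>] Suc by simp
qed simp

text \<open>The spectral theorem writes \<open>B - A\<close> as a sum of rank one terms with weights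
  \<open>d i \<ge> 0\<close>. Only \<open>A\<close> is assumed to lie in the cone; the intermediate
  matrices inherit this from the monotonicity already shown.\<close>

lemma minor_sum_mono:
  fixes A B :: "real^'n^'n::finite"
  assumes A: "transpose A = A" and B: "transpose B = B"
    and le: "\<And>x. x \<bullet> (A *v x) \<le> x \<bullet> (B *v x)"
    and pos: "\<And>j. j \<le> k \<Longrightarrow> 0 < minor_sum j A" and j: "j \<le> k"
  shows "minor_sum j A \<le> minor_sum j B"
proof -
  have sym: "transpose (B - A) = B - A" using A B by (simp add: transpose_def vec_eq_iff)
  obtain Q d where Q: "orthogonal_matrix Q" "transpose Q ** (B - A) ** Q = diag_mat d"
    using symmetric_matrix_diagonalization[OF sym] by metis
  have d: "0 \<le> d i" for i
  proof -
    have "d i = (transpose Q ** (B - A) ** Q) $ i $ i" by (simp add: Q(2) diag_mat_def)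
    also have "\<dots> = column i Q \<bullet> ((B - A) *v column i Q)" by (rule conj_entry)
    finally show ?thesis using le by (simp add: matrix_vector_mult_diff_rdistrib inner_diff_right)
  qed
  have QQ: "Q ** transpose Q = mat 1" using Q(1) by (simp add: orthogonal_matrix_def)
  have "Q ** diag_mat d ** transpose Q = (Q ** transpose Q) ** (B - A) ** (Q ** transpose Q)"
    unfolding Q(2)[symmetric] by (simp add: matrix_mul_assoc)
  then have "B - A = Q ** diag_mat d ** transpose Q" by (simp add: QQ)
  also have "\<dots> = (\<Sum>i\<in>UNIV. d i *\<^sub>R outer (column i Q))"
    by (simp add: vec_eq_iff matrix_matrix_mult_def diag_mat_def outer_def column_def transpose_def
        if_distrib[of "\<lambda>x. _ * x"] sum.delta' mult_ac cong: if_cong)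
  finally have BA: "B = A + (\<Sum>i\<in>UNIV. d i *\<^sub>R outer (column i Q))" by (simp add: algebra_simps)
  \<comment> \<open>All orders up to \<open>k\<close> are carried together, because adding the next
    term needs positivity in every one of them.\<close>
  have "\<forall>j\<le>k. minor_sum j A \<le> minor_sum j (A + (\<Sum>i\<in>I. d i *\<^sub>R outer (column i Q)))
      \<and> transpose (A + (\<Sum>i\<in>I. d i *\<^sub>R outer (column i Q))) = A + (\<Sum>i\<in>I. d i *\<^sub>R outer (column i Q))"
    for I :: "'n set"
  proof (induction I rule: finite_induct[OF finite])
    case 1
    then show ?case using A by simp
  next
    case (2 i I)
    let ?M = "A + (\<Sum>i\<in>I. d i *\<^sub>R outer (column i Q))"
    have M: "transpose ?M = ?M" "\<And>j. j \<le> k \<Longrightarrow> minor_sum j A \<le> minor_sum j ?M" using 2(3) by auto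
    have eq: "A + (\<Sum>i\<in>insert i I. d i *\<^sub>R outer (column i Q)) = ?M + d i *\<^sub>R outer (column i Q)"
      using 2(1,2) by (simp add: algebra_simps)
    have "minor_sum j ?M \<le> minor_sum j (?M + d i *\<^sub>R outer (column i Q))" if "j \<le> k" for j
    proof (rule minor_sum_rank_one_mono[OF M(1) d _ that])
      show "0 < minor_sum j ?M" if "j \<le> k" for j using pos[OF that] M(2)[OF that] by linarith
    qed
    moreover have "transpose (?M + d i *\<^sub>R outer (column i Q)) = ?M + d i *\<^sub>R outer (column i Q)"
      using M(1) transpose_outer[of "column i Q"] by (simp add: transpose_def vec_eq_iff)
    ultimately show ?case unfolding eq using M(2) order_trans by blast
  qed
  then show ?thesis using j BA by metis
qed

section \<open>Perturbations of an orthogonal projection\<close>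

lemma orth_proj_works:
  assumes "subspace S"
  shows "orth_proj S x \<in> S \<and> x - orth_proj S x \<in> orthogonal_comp S"
proof -
  have S: "span S = S" using assms by (simp add: span_eq_iff)
  obtain y z where yz: "y \<in> span S" "\<And>w. w \<in> span S \<Longrightarrow> orthogonal z w" "x = y + z"
    using orthogonal_subspace_decomp_exists[of S x] by blast
  show ?thesis unfolding orth_proj_def
  proof (rule theI)
    show "y \<in> S \<and> x - y \<in> orthogonal_comp S"
      using yz S by (auto simp: orthogonal_comp_def orthogonal_commute)
  next
    fix p assume p: "p \<in> S \<and> x - p \<in> orthogonal_comp S"
    then have "p - y \<in> S" using yz S assms by (auto intro: subspace_diff)
    then have "orthogonal (p - y) (x - p)" "orthogonal (p - y) z"
      using p yz(2)[of "p - y"] S by (auto simp: orthogonal_comp_def orthogonal_commute[of z])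
    then have "(p - y) \<bullet> (x - p) = 0" "(p - y) \<bullet> z = 0" by (auto simp: orthogonal_def)
    then have "(p - y) \<bullet> (p - y) = 0" using yz(3) by (simp add: inner_diff_right inner_add_right algebra_simps)
    then show "p = y" by simp
  qed
qed

lemma orth_proj_unique:
  assumes "subspace S" "p \<in> S" "x - p \<in> orthogonal_comp S"
  shows "orth_proj S x = p"
proof -
  let ?q = "orth_proj S x"
  have q: "?q \<in> S" "x - ?q \<in> orthogonal_comp S" using orth_proj_works[OF assms(1)] by auto
  then have "p - ?q \<in> S" using assms by (auto intro: subspace_diff)
  then have "(p - ?q) \<bullet> (x - p) = 0" "(p - ?q) \<bullet> (x - ?q) = 0"
    using q assms by (auto simp: orthogonal_comp_def orthogonal_def)
  then have "(p - ?q) \<bullet> (p - ?q) = 0" by (simp add: inner_diff_right)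
  then show ?thesis by simp
qed

lemma linear_orth_proj:
  assumes "subspace S"
  shows "linear (orth_proj S)"
proof (rule linearI)
  note P = orth_proj_works[OF assms]
  note C = subspace_orthogonal_comp[of S]
  fix x y and c :: real
  have "x + y - (orth_proj S x + orth_proj S y) = (x - orth_proj S x) + (y - orth_proj S y)" by simp
  then show "orth_proj S (x + y) = orth_proj S x + orth_proj S y"
    using P[of x] P[of y] C assms by (intro orth_proj_unique) (auto simp only: intro: subspace_add)
  have "c *\<^sub>R x - c *\<^sub>R orth_proj S x = c *\<^sub>R (x - orth_proj S x)" by (simp add: scaleR_diff_right)
  then show "orth_proj S (c *\<^sub>R x) = c *\<^sub>R orth_proj S x"
    using P[of x] C assms by (intro orth_proj_unique) (auto simp only: intro: subspace_scale)
qed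

lemma orth_proj_selfadjoint:
  assumes "subspace S"
  shows "orth_proj S x \<bullet> y = x \<bullet> orth_proj S y"
proof -
  have "orth_proj S x \<bullet> (y - orth_proj S y) = 0" "(x - orth_proj S x) \<bullet> orth_proj S y = 0"
    using orth_proj_works[OF assms]
    by (auto simp: orthogonal_comp_def orthogonal_def inner_commute[of "x - orth_proj S x"])
  then show ?thesis by (simp add: inner_diff_left inner_diff_right)
qed

lemma orth_proj_fix: "subspace S \<Longrightarrow> x \<in> S \<Longrightarrow> orth_proj S x = x"
  by (rule orth_proj_unique) (auto simp: orthogonal_comp_def orthogonal_def)

lemma orth_proj_comp:
  assumes "subspace S"
  shows "orth_proj (orthogonal_comp S) x = x - orth_proj S x"
proof (rule orth_proj_unique)
  show "x - (x - orth_proj S x) \<in> orthogonal_comp (orthogonal_comp S)"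
    using orth_proj_works[OF assms, of x] orthogonal_comp_subset by auto
qed (use orth_proj_works[OF assms] subspace_orthogonal_comp in auto)

lemma matrix_orth_proj: "subspace S \<Longrightarrow> matrix (orth_proj S) *v x = orth_proj S x"
  by (simp add: matrix_works linear_orth_proj linear_matrix_vector_mul_eq)

lemma transpose_matrix_orth_proj:
  assumes "subspace S"
  shows "transpose (matrix (orth_proj S)) = matrix (orth_proj S)"
proof -
  have "orth_proj S (axis i 1) $ j = orth_proj S (axis j 1) $ i" for i j
    using orth_proj_selfadjoint[OF assms, of "axis i 1" "axis j 1"] by (simp add: inner_axis inner_axis')
  then show ?thesis by (simp add: transpose_def matrix_def vec_eq_iff)
qed

text \<open>Idempotence forces the eigenvalues 0 and 1, and the columns with eigenvalue 1 form a
  basis of \<open>E\<close>, which gives the size of \<open>T\<close>.\<close>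

lemma orth_proj_diagonalization:
  fixes E :: "(real^'n::finite) set"
  assumes E: "subspace E"
  obtains Q T where "orthogonal_matrix Q" "card T = dim E"
    "transpose Q ** matrix (orth_proj E) ** Q = diag_mat (\<lambda>i. if i \<in> T then 1 else 0)"
proof -
  obtain Q d where Q: "orthogonal_matrix Q"
    and D: "transpose Q ** matrix (orth_proj E) ** Q = diag_mat d"
    and eig: "\<And>i. matrix (orth_proj E) *v column i Q = d i *\<^sub>R column i Q"
    using symmetric_matrix_diagonalization[OF transpose_matrix_orth_proj[OF E]] by metis
  let ?q = "\<lambda>i. column i Q"
  have eig': "orth_proj E (?q i) = d i *\<^sub>R ?q i" for i using eig matrix_orth_proj[OF E] by simp
  have unit: "?q i \<bullet> ?q j = (if i = j then 1 else 0)" for i j by (rule column_inner[OF Q])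
  then have nz: "?q i \<noteq> 0" for i by (metis inner_zero_left zero_neq_one)
  have d01: "d i = 0 \<or> d i = 1" for i
  proof -
    have "orth_proj E (orth_proj E (?q i)) = orth_proj E (?q i)"
      using orth_proj_fix[OF E] orth_proj_works[OF E] by blast
    then have "(d i * d i) *\<^sub>R ?q i = d i *\<^sub>R ?q i"
      using linear_scale[OF linear_orth_proj[OF E]] by (simp add: eig')
    then show ?thesis using nz by simp
  qed
  define T where "T = {i. d i = 1}"
  have inj: "inj ?q"
    by (rule injI) (metis unit zero_neq_one)
  have "independent (?q ` T)"
    using unit nz by (intro pairwise_orthogonal_independent) (auto simp: pairwise_def orthogonal_def)
  moreover have "?q ` T \<subseteq> E"
  proof safe
    fix i assume "i \<in> T"
    then have "orth_proj E (?q i) = ?q i" by (simp add: eig' T_def)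
    then show "?q i \<in> E" using orth_proj_works[OF E, of "?q i"] by simp
  qed
  moreover have "E \<subseteq> span (?q ` T)"
  proof
    fix x assume x: "x \<in> E"
    have zero: "?q i \<bullet> x = 0" if "i \<notin> T" for i
    proof -
      have "d i = 0" using that d01 by (auto simp: T_def)
      then show ?thesis
        using orth_proj_selfadjoint[OF E, of "?q i" x] orth_proj_fix[OF E x] by (simp add: eig')
    qed
    have "Q *v (transpose Q *v x) = x"
      using Q by (metis matrix_vector_mul_assoc matrix_vector_mul_lid orthogonal_matrix_def)
    then have "x = (\<Sum>i\<in>UNIV. (?q i \<bullet> x) *\<^sub>R ?q i)"
      by (simp add: vec_eq_iff matrix_vector_mult_def transpose_def column_def inner_vec_def mult.commute)
    also have "\<dots> = (\<Sum>i\<in>T. (?q i \<bullet> x) *\<^sub>R ?q i)"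
      using zero by (intro sum.mono_neutral_right) auto
    also have "\<dots> \<in> span (?q ` T)" by (intro span_sum span_scale span_base) auto
    finally show "x \<in> span (?q ` T)" .
  qed
  ultimately have "card (?q ` T) = dim E" by (metis dim_unique)
  then have "card T = dim E" using inj by (metis card_image inj_on_subset subset_UNIV)
  moreover have "d = (\<lambda>i. if i \<in> T then 1 else 0)" using d01 by (auto simp: T_def fun_eq_iff)
  ultimately show ?thesis using that Q D by simp
qed

lemma trace_conj:
  fixes M Q :: "real^'n^'n::finite"
  assumes "orthogonal_matrix Q"
  shows "trace (transpose Q ** M ** Q) = trace M"
  by (metis assms matrix_mul_assoc matrix_mul_rid orthogonal_matrix_def trace_mul_sym)

text \<open>\<open>minor_sum_perturbation\<close> carried over by the rotation that diagonalizes the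
  projection onto \<open>E\<close>.\<close>

lemma minor_sum_projection_perturbation:
  fixes E :: "(real^'n::finite) set"
  assumes E: "subspace E" "dim E = m" and C: "0 \<le> C"
  obtains K where "0 \<le> K"
    "\<And>A :: real^'n^'n. \<And>\<epsilon>. (\<And>i j. \<bar>A $ i $ j\<bar> \<le> C) \<Longrightarrow> 0 \<le> \<epsilon> \<Longrightarrow> \<epsilon> \<le> 1 \<Longrightarrow>
       \<bar>minor_sum (Suc m) (matrix (orth_proj E) + \<epsilon> *\<^sub>R A)
          - \<epsilon> * trace (matrix (orth_proj (orthogonal_comp E)) ** A)\<bar> \<le> K * \<epsilon>\<^sup>2"
    "\<And>A :: real^'n^'n. \<And>\<epsilon> j. (\<And>i j. \<bar>A $ i $ j\<bar> \<le> C) \<Longrightarrow> 0 \<le> \<epsilon> \<Longrightarrow> \<epsilon> \<le> 1 \<Longrightarrow> j \<le> m \<Longrightarrow>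
       1 - K * \<epsilon> \<le> minor_sum j (matrix (orth_proj E) + \<epsilon> *\<^sub>R A)"
proof -
  let ?P = "matrix (orth_proj E)"
  obtain Q T where Q: "orthogonal_matrix Q" and T: "card T = m"
    and D: "transpose Q ** ?P ** Q = diag_mat (\<lambda>i. if i \<in> T then 1 else 0)"
    using orth_proj_diagonalization[OF E(1)] E(2) by metis
  have QQ: "Q ** transpose Q = mat 1" using Q by (simp add: orthogonal_matrix_def)
  \<comment> \<open>Entries of \<open>Q\<close> are at most 1 in absolute value, so an entry of the
    conjugate of \<open>A\<close> is a sum of \<open>CARD('n)\<close> squared many terms bounded by
    \<open>C\<close>. The extra 1 secures \<open>1 \<le> C'\<close>.\<close>
  define C' where "C' = real (CARD('n) * CARD('n)) * C + 1"
  have C': "1 \<le> C'" using C by (simp add: C'_def)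
  have Qle: "\<bar>Q $ i $ j\<bar> \<le> 1" for i j
  proof -
    have "\<bar>Q $ i $ j\<bar> \<le> norm (column j Q)"
      using component_le_norm_cart[of "column j Q" i] by (simp add: column_def)
    then show ?thesis using Q by (simp add: orthogonal_matrix_orthonormal_columns)
  qed
  have bound: "\<bar>(transpose Q ** A ** Q) $ i $ j\<bar> \<le> C'" if A: "\<And>i j. \<bar>A $ i $ j\<bar> \<le> C" for A i j
  proof -
    have "(transpose Q ** A ** Q) $ i $ j = (\<Sum>a\<in>UNIV. \<Sum>b\<in>UNIV. Q $ a $ i * A $ a $ b * Q $ b $ j)"
      unfolding conj_entry
      by (simp add: inner_vec_def matrix_vector_mult_def column_def sum_distrib_left mult.assoc)
    also have "\<bar>\<dots>\<bar> \<le> (\<Sum>a\<in>(UNIV :: 'n set). \<Sum>b\<in>(UNIV :: 'n set). C)"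
    proof (rule order_trans[OF sum_abs sum_mono])
      fix a
      show "\<bar>\<Sum>b\<in>UNIV. Q $ a $ i * A $ a $ b * Q $ b $ j\<bar> \<le> (\<Sum>b\<in>(UNIV :: 'n set). C)"
      proof (rule order_trans[OF sum_abs sum_mono])
        fix b
        have "\<bar>Q $ a $ i\<bar> * \<bar>A $ a $ b\<bar> * \<bar>Q $ b $ j\<bar> \<le> 1 * C * 1"
          by (intro mult_mono Qle A) (use C in auto)
        then show "\<bar>Q $ a $ i * A $ a $ b * Q $ b $ j\<bar> \<le> C" by (simp add: abs_mult)
      qed
    qed
    finally show ?thesis by (simp add: C'_def)
  qed
  have conj: "minor_sum j (?P + \<epsilon> *\<^sub>R A)
      = minor_sum j (diag_mat (\<lambda>i. if i \<in> T then 1 else 0) + \<epsilon> *\<^sub>R (transpose Q ** A ** Q))" for j \<epsilon> A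
  proof -
    have "transpose Q ** (?P + \<epsilon> *\<^sub>R A) ** Q
        = diag_mat (\<lambda>i. if i \<in> T then 1 else 0) + \<epsilon> *\<^sub>R (transpose Q ** A ** Q)"
      unfolding D[symmetric]
      by (simp add: vec_eq_iff conj_entry matrix_vector_mult_add_rdistrib inner_add_right
          scaleR_matrix_vector_assoc[symmetric])
    then show ?thesis using minor_sum_orthogonal_conj[OF Q] by metis
  qed
  \<comment> \<open>The projection onto the complement is the identity minus that onto
    \<open>E\<close>, so the same \<open>Q\<close> diagonalizes it, with ones outside
    \<open>T\<close>.\<close>
  have tr: "trace (matrix (orth_proj (orthogonal_comp E)) ** A) = (\<Sum>i\<in>- T. (transpose Q ** A ** Q) $ i $ i)" for A
  proof -
    let ?V = "matrix (orth_proj (orthogonal_comp E))"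
    have V: "?V = mat 1 - ?P"
      unfolding matrix_def orth_proj_comp[OF E(1)] by (simp add: vec_eq_iff mat_def axis_def)
    have "trace (?V ** A) = trace (transpose Q ** (?V ** A) ** Q)" by (simp add: trace_conj[OF Q])
    also have "transpose Q ** (?V ** A) ** Q = (transpose Q ** ?V ** Q) ** (transpose Q ** A ** Q)"
      by (metis QQ matrix_mul_assoc matrix_mul_lid)
    also have "transpose Q ** ?V ** Q = diag_mat (\<lambda>i. if i \<in> T then 0 else 1)"
    proof -
      have "transpose Q ** ?V ** Q = mat 1 - transpose Q ** ?P ** Q"
      proof -
        have "(transpose Q ** ?V ** Q) $ i $ j = (mat 1 - transpose Q ** ?P ** Q) $ i $ j" for i j
          using column_inner[OF Q, of i j] unfolding V vector_minus_component conj_entry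
          by (simp add: matrix_vector_mult_diff_rdistrib inner_diff_right) (simp add: mat_def)
        then show ?thesis by (simp add: vec_eq_iff)
      qed
      then show ?thesis unfolding D by (simp add: vec_eq_iff diag_mat_def mat_def)
    qed
    also have "trace (diag_mat (\<lambda>i. if i \<in> T then 0 else 1) ** (transpose Q ** A ** Q))
        = (\<Sum>i\<in>UNIV. if i \<in> T then 0 else (transpose Q ** A ** Q) $ i $ i)"
    proof -
      have "(diag_mat e ** M) $ i $ j = e i * M $ i $ j" for e and M :: "real^'n^'n" and i j
        by (simp add: matrix_matrix_mult_def diag_mat_def if_distrib[of "\<lambda>x. x * _"] cong: if_cong)
      then show ?thesis by (simp add: trace_def if_distrib[of "\<lambda>x. x * _"] cong: if_cong)
    qed
    also have "\<dots> = (\<Sum>i\<in>- T. (transpose Q ** A ** Q) $ i $ i)"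
      by (intro sum.mono_neutral_cong_right) auto
    finally show ?thesis .
  qed
  obtain K where K: "0 \<le> K"
    "\<And>A :: real^'n^'n. \<And>\<epsilon>. (\<And>i j. \<bar>A $ i $ j\<bar> \<le> C') \<Longrightarrow> 0 \<le> \<epsilon> \<Longrightarrow> \<epsilon> \<le> 1 \<Longrightarrow>
       \<bar>minor_sum (Suc m) (diag_mat (\<lambda>i. if i \<in> T then 1 else 0) + \<epsilon> *\<^sub>R A)
          - \<epsilon> * (\<Sum>i\<in>- T. A $ i $ i)\<bar> \<le> K * \<epsilon>\<^sup>2"
    "\<And>A :: real^'n^'n. \<And>\<epsilon> j. (\<And>i j. \<bar>A $ i $ j\<bar> \<le> C') \<Longrightarrow> 0 \<le> \<epsilon> \<Longrightarrow> \<epsilon> \<le> 1 \<Longrightarrow> j \<le> m \<Longrightarrow>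
       1 - K * \<epsilon> \<le> minor_sum j (diag_mat (\<lambda>i. if i \<in> T then 1 else 0) + \<epsilon> *\<^sub>R A)"
    using minor_sum_perturbation[OF T C'] by blast
  show ?thesis
    by (rule that[OF K(1)]) (use K(2,3) bound in \<open>auto simp: conj tr\<close>)
qed

lemma minor_sum_smult: "minor_sum j (c *\<^sub>R M) = c ^ j * minor_sum j M"
  by (simp add: minor_sum_def principal_minor_smult sum_distrib_left)

section \<open>Second order calculus\<close>

lemma has_derivative_pderiv_dir:
  fixes u :: "real^'n::finite \<Rightarrow> real"
  assumes "u differentiable (at x)"
  shows "(u has_derivative (\<lambda>h. \<Sum>i\<in>UNIV. pderiv_dir i u x * h $ i)) (at x)"
proof -
  let ?F = "frechet_derivative u (at x)"
  have F: "(u has_derivative ?F) (at x)" using assms frechet_derivative_works by blast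
  have lin: "linear ?F" using assms by (rule linear_frechet_derivative)
  have "?F h = (\<Sum>i\<in>UNIV. pderiv_dir i u x * h $ i)" for h
  proof -
    have "?F h = ?F (\<Sum>i\<in>UNIV. h $ i *\<^sub>R axis i 1)"
      using basis_expansion[of h] by (simp add: scalar_mult_eq_scaleR)
    also have "\<dots> = (\<Sum>i\<in>UNIV. h $ i * ?F (axis i 1))"
      using lin by (simp add: linear_sum linear_scale)
    finally show ?thesis by (simp add: pderiv_dir_def mult.commute)
  qed
  then have "?F = (\<lambda>h. \<Sum>i\<in>UNIV. pderiv_dir i u x * h $ i)" by (rule ext)
  then show ?thesis using F by simp
qed

lemma pderiv_dir_eqI: "(u has_derivative F) (at x) \<Longrightarrow> pderiv_dir i u x = F (axis i 1)"
  unfolding pderiv_dir_def using frechet_derivative_at by metis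

lemma pderiv_dir_cong:
  assumes "open U" "x \<in> U" "\<And>y. y \<in> U \<Longrightarrow> f y = g y"
  shows "pderiv_dir i f x = pderiv_dir i g x"
proof -
  have "(f has_derivative F) (at x) \<longleftrightarrow> (g has_derivative F) (at x)" for F
    using has_derivative_transform_within_open[of f F x UNIV U g]
      has_derivative_transform_within_open[of g F x UNIV U f] assms by auto
  then show ?thesis by (simp add: pderiv_dir_def frechet_derivative_def)
qed

lemma line_has_real_derivative:
  fixes u :: "real^'n::finite \<Rightarrow> real"
  assumes "u differentiable (at (a + s *\<^sub>R \<xi>))"
  shows "((\<lambda>s. u (a + s *\<^sub>R \<xi>)) has_real_derivative (\<Sum>i\<in>UNIV. pderiv_dir i u (a + s *\<^sub>R \<xi>) * \<xi> $ i)) (at s)"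
proof -
  have "((\<lambda>s. a + s *\<^sub>R \<xi>) has_derivative (\<lambda>h. h *\<^sub>R \<xi>)) (at s)"
    by (auto intro!: derivative_eq_intros)
  from has_derivative_compose[OF this has_derivative_pderiv_dir[OF assms]]
  have "((\<lambda>s. u (a + s *\<^sub>R \<xi>)) has_derivative
      (\<lambda>h. \<Sum>i\<in>UNIV. pderiv_dir i u (a + s *\<^sub>R \<xi>) * (h *\<^sub>R \<xi>) $ i)) (at s)" .
  moreover have "(\<lambda>h. \<Sum>i\<in>UNIV. pderiv_dir i u (a + s *\<^sub>R \<xi>) * (h *\<^sub>R \<xi>) $ i)
      = (*) (\<Sum>i\<in>UNIV. pderiv_dir i u (a + s *\<^sub>R \<xi>) * \<xi> $ i)"
    by (simp add: fun_eq_iff sum_distrib_left mult_ac)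
  ultimately show ?thesis by (simp add: has_field_derivative_def)
qed

lemma axis_has_real_derivative:
  fixes u :: "real^'n::finite \<Rightarrow> real"
  assumes "u differentiable (at (a + s *\<^sub>R axis i 1))"
  shows "((\<lambda>s. u (a + s *\<^sub>R axis i 1)) has_real_derivative pderiv_dir i u (a + s *\<^sub>R axis i 1)) (at s)"
proof -
  have "(\<Sum>k\<in>UNIV. pderiv_dir k u y * (axis i 1 :: real^'n) $ k) = pderiv_dir i u y" for y
    by (simp add: axis_def if_distrib[of "\<lambda>x. _ * x"] cong: if_cong)
  then show ?thesis using line_has_real_derivative[OF assms] by simp
qed

lemma open_line_mem:
  fixes a d :: "'a::real_normed_vector"
  assumes "open U" "a \<in> U"
  shows "\<exists>r>0. \<forall>s. \<bar>s\<bar> < r \<longrightarrow> a + s *\<^sub>R d \<in> U"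
proof -
  have "open ((\<lambda>s. a + s *\<^sub>R d) -` U)"
    using assms(1) by (intro open_vimage continuous_intros)
  moreover have "(0::real) \<in> (\<lambda>s. a + s *\<^sub>R d) -` U" using assms(2) by simp
  ultimately obtain r where r: "r > 0" "ball 0 r \<subseteq> (\<lambda>s. a + s *\<^sub>R d) -` U"
    by (rule openE)
  then have "a + s *\<^sub>R d \<in> U" if "\<bar>s\<bar> < r" for s
    using that by (auto simp: subset_iff dist_real_def)
  then show ?thesis using r(1) by blast
qed

lemma Ck_on_2D:
  assumes "Ck_on 2 \<Omega> u"
  shows "x \<in> \<Omega> \<Longrightarrow> u differentiable (at x)"
    and "x \<in> \<Omega> \<Longrightarrow> pderiv_dir i u differentiable (at x)"
    and "continuous_on \<Omega> (pderiv_dir i (pderiv_dir j u))"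
proof -
  note C = assms[unfolded Ck_on_def]
  show "x \<in> \<Omega> \<Longrightarrow> u differentiable (at x)" using C[THEN conjunct1, rule_format, of "[]"] by simp
  show "x \<in> \<Omega> \<Longrightarrow> pderiv_dir i u differentiable (at x)"
    using C[THEN conjunct1, rule_format, of "[i]"] by simp
  show "continuous_on \<Omega> (pderiv_dir i (pderiv_dir j u))"
    using C[THEN conjunct2, rule_format, of "[i, j]"] by simp
qed

text \<open>The mean value theorem applied twice, first in direction \<open>i\<close> to the
  difference of \<open>u\<close> along two parallel segments, then in direction \<open>j\<close> to
  the partial derivative. The condition \<open>2 * h < r\<close> keeps the square inside the
  ball.\<close>

lemma second_difference:
  fixes u :: "real^'n::finite \<Rightarrow> real"
  assumes u: "Ck_on 2 \<Omega> u" and r: "ball x r \<subseteq> \<Omega>" and h: "0 < h" "2 * h < r"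
  obtains y where "dist x y \<le> 2 * h"
    "u (x + h *\<^sub>R axis i 1 + h *\<^sub>R axis j 1) - u (x + h *\<^sub>R axis i 1) - u (x + h *\<^sub>R axis j 1) + u x
       = h * (h * pderiv_dir j (pderiv_dir i u) y)"
proof -
  let ?e = "\<lambda>i. axis i 1 :: real^'n"
  have near: "dist x (x + s *\<^sub>R ?e i + t *\<^sub>R ?e j) \<le> 2 * h" if "0 \<le> s" "s \<le> h" "0 \<le> t" "t \<le> h" for s t i j
  proof -
    have "norm (s *\<^sub>R ?e i + t *\<^sub>R ?e j) \<le> norm (s *\<^sub>R ?e i) + norm (t *\<^sub>R ?e j)" by (rule norm_triangle_ineq)
    moreover have "dist x (x + s *\<^sub>R ?e i + t *\<^sub>R ?e j) = norm (s *\<^sub>R ?e i + t *\<^sub>R ?e j)"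
      by (metis add.assoc add_diff_cancel_left' dist_commute dist_norm)
    ultimately show ?thesis using that by (simp add: norm_axis_1)
  qed
  then have mem: "x + s *\<^sub>R ?e i + t *\<^sub>R ?e j \<in> \<Omega>" if "0 \<le> s" "s \<le> h" "0 \<le> t" "t \<le> h" for s t i j
  proof -
    have "x + s *\<^sub>R ?e i + t *\<^sub>R ?e j \<in> ball x r"
      unfolding mem_ball using near[OF that, of i j] h(2) by linarith
    then show ?thesis using r by blast
  qed
  have mem1: "x + s *\<^sub>R ?e i \<in> \<Omega>" if "0 \<le> s" "s \<le> h" for s i
    using mem[of s 0 i i] that h by simp
  have "\<exists>s>0. s < h \<and> (u (x + h *\<^sub>R ?e j + h *\<^sub>R ?e i) - u (x + h *\<^sub>R ?e i)) - (u (x + h *\<^sub>R ?e j + 0 *\<^sub>R ?e i) - u (x + 0 *\<^sub>R ?e i))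
      = (h - 0) * (pderiv_dir i u (x + h *\<^sub>R ?e j + s *\<^sub>R ?e i) - pderiv_dir i u (x + s *\<^sub>R ?e i))"
    using h(1) by (rule MVT2) (use mem[of h _ j i] mem1 h in \<open>auto intro!: DERIV_diff axis_has_real_derivative Ck_on_2D(1)[OF u]\<close>)
  then obtain s where s: "0 < s" "s < h" and 1:
    "u (x + h *\<^sub>R ?e i + h *\<^sub>R ?e j) - u (x + h *\<^sub>R ?e i) - u (x + h *\<^sub>R ?e j) + u x
      = h * (pderiv_dir i u (x + s *\<^sub>R ?e i + h *\<^sub>R ?e j) - pderiv_dir i u (x + s *\<^sub>R ?e i))"
    by (auto simp: algebra_simps)
  have "\<exists>t>0. t < h \<and> pderiv_dir i u (x + s *\<^sub>R ?e i + h *\<^sub>R ?e j) - pderiv_dir i u (x + s *\<^sub>R ?e i + 0 *\<^sub>R ?e j)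
      = (h - 0) * pderiv_dir j (pderiv_dir i u) (x + s *\<^sub>R ?e i + t *\<^sub>R ?e j)"
    using h(1) by (rule MVT2) (use mem[of s] s in \<open>auto intro!: axis_has_real_derivative Ck_on_2D(2)[OF u]\<close>)
  then obtain t where t: "0 < t" "t < h" and 2:
    "pderiv_dir i u (x + s *\<^sub>R ?e i + h *\<^sub>R ?e j) - pderiv_dir i u (x + s *\<^sub>R ?e i)
      = h * pderiv_dir j (pderiv_dir i u) (x + s *\<^sub>R ?e i + t *\<^sub>R ?e j)"
    by auto
  show ?thesis using that[OF near[of s t i j]] s t 1 2 by simp
qed

text \<open>Schwarz's theorem: the second difference is symmetric in \<open>i\<close> and
  \<open>j\<close>, so the two mixed derivatives agree at points arbitrarily near \<open>x\<close>,
  and continuity concludes. Symmetry of the Hessian is what opens the way to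
  \<open>sigma_symmetric\<close>.\<close>

lemma pderiv_dir_commute:
  fixes u :: "real^'n::finite \<Rightarrow> real"
  assumes u: "Ck_on 2 \<Omega> u" and "open \<Omega>" "x \<in> \<Omega>"
  shows "pderiv_dir i (pderiv_dir j u) x = pderiv_dir j (pderiv_dir i u) x"
proof -
  let ?D = "\<lambda>i j. pderiv_dir i (pderiv_dir j u)"
  obtain r where r: "r > 0" "ball x r \<subseteq> \<Omega>" using assms open_contains_ball by blast
  have "\<bar>?D i j x - ?D j i x\<bar> \<le> e" if e: "e > 0" for e
  proof -
    have cont: "isCont (?D i j) x" for i j
      using Ck_on_2D(3)[OF u] assms(2,3) by (simp add: continuous_on_eq_continuous_at)
    have "\<exists>d>0. \<forall>y. dist x y < d \<longrightarrow> \<bar>?D i j y - ?D i j x\<bar> < e / 2" for i j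
      using cont[of i j] e unfolding continuous_at_eps_delta
      by (auto simp: dist_commute dist_real_def dest!: spec[of _ "e / 2"])
    then obtain d1 d2 where d: "d1 > 0" "\<And>y. dist x y < d1 \<Longrightarrow> \<bar>?D i j y - ?D i j x\<bar> < e / 2"
      "d2 > 0" "\<And>y. dist x y < d2 \<Longrightarrow> \<bar>?D j i y - ?D j i x\<bar> < e / 2" by meson
    \<comment> \<open>A third of the smallest radius, so that twice \<open>h\<close> stays below all
      three.\<close>
    define h where "h = min r (min d1 d2) / 3"
    have h: "0 < h" "2 * h < r" "2 * h < d1" "2 * h < d2" using r(1) d(1,3) by (auto simp: h_def)
    obtain y where y: "dist x y \<le> 2 * h"
      "u (x + h *\<^sub>R axis i 1 + h *\<^sub>R axis j 1) - u (x + h *\<^sub>R axis i 1) - u (x + h *\<^sub>R axis j 1) + u x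
       = h * (h * ?D j i y)" using second_difference[OF u r(2) h(1,2), of i j] by blast
    obtain z where z: "dist x z \<le> 2 * h"
      "u (x + h *\<^sub>R axis j 1 + h *\<^sub>R axis i 1) - u (x + h *\<^sub>R axis j 1) - u (x + h *\<^sub>R axis i 1) + u x
       = h * (h * ?D i j z)" using second_difference[OF u r(2) h(1,2), of j i] by blast
    have "x + h *\<^sub>R axis j 1 + h *\<^sub>R axis i 1 = x + h *\<^sub>R axis i 1 + h *\<^sub>R axis j 1" by simp
    then have "h * (h * ?D j i y) = h * (h * ?D i j z)" using y(2) z(2) by (metis diff_diff_eq add.commute)
    then have "?D j i y = ?D i j z" using h(1) by simp
    moreover have "\<bar>?D j i y - ?D j i x\<bar> < e / 2" "\<bar>?D i j z - ?D i j x\<bar> < e / 2"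
      using d y(1) z(1) h by auto
    ultimately show ?thesis by linarith
  qed
  then have "\<bar>?D i j x - ?D j i x\<bar> \<le> 0" by (metis field_le_epsilon add_0)
  then show ?thesis by simp
qed

lemma transpose_hessian:
  "Ck_on 2 \<Omega> u \<Longrightarrow> open \<Omega> \<Longrightarrow> x \<in> \<Omega> \<Longrightarrow> transpose (hessian u x) = hessian u x"
  by (simp add: hessian_def transpose_def vec_eq_iff pderiv_dir_commute)

lemma pderiv_dir_lincomb:
  fixes u v :: "real^'n::finite \<Rightarrow> real"
  assumes "u differentiable (at x)" "v differentiable (at x)"
  shows "pderiv_dir i (\<lambda>x. a * u x + b * v x) x = a * pderiv_dir i u x + b * pderiv_dir i v x"
proof -
  have "((\<lambda>x. a * u x + b * v x) has_derivative
      (\<lambda>h. a * frechet_derivative u (at x) h + b * frechet_derivative v (at x) h)) (at x)"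
    using assms by (intro has_derivative_add has_derivative_mult_right) (simp_all add: frechet_derivative_works[symmetric])
  then show ?thesis by (simp add: pderiv_dir_eqI) (simp add: pderiv_dir_def)
qed

lemma pderiv_dir_lincomb_on:
  fixes u v :: "real^'n::finite \<Rightarrow> real"
  assumes "Ck_on 2 \<Omega> u" "Ck_on 2 \<Omega> v" "open \<Omega>" "x \<in> \<Omega>"
  shows "pderiv_dir i (pderiv_dir j (\<lambda>x. a * u x + b * v x)) x
    = a * pderiv_dir i (pderiv_dir j u) x + b * pderiv_dir i (pderiv_dir j v) x"
proof -
  have "pderiv_dir i (pderiv_dir j (\<lambda>x. a * u x + b * v x)) x
      = pderiv_dir i (\<lambda>x. a * pderiv_dir j u x + b * pderiv_dir j v x) x"
    by (rule pderiv_dir_cong[OF assms(3,4)], rule pderiv_dir_lincomb) (use assms Ck_on_2D in blast)+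
  also have "\<dots> = a * pderiv_dir i (pderiv_dir j u) x + b * pderiv_dir i (pderiv_dir j v) x"
    by (rule pderiv_dir_lincomb) (use assms Ck_on_2D in blast)+
  finally show ?thesis .
qed

lemma hessian_lincomb:
  fixes u v :: "real^'n::finite \<Rightarrow> real"
  assumes "Ck_on 2 \<Omega> u" "Ck_on 2 \<Omega> v" "open \<Omega>" "x \<in> \<Omega>"
  shows "hessian (\<lambda>x. a * u x + b * v x) x = a *\<^sub>R hessian u x + b *\<^sub>R hessian v x"
  by (simp add: hessian_def vec_eq_iff pderiv_dir_lincomb_on[OF assms])

lemma Ck_on_2I:
  assumes "\<And>x. x \<in> \<Omega> \<Longrightarrow> u differentiable (at x)"
    and "\<And>x i. x \<in> \<Omega> \<Longrightarrow> pderiv_dir i u differentiable (at x)"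
    and "\<And>i j. continuous_on \<Omega> (pderiv_dir i (pderiv_dir j u))"
  shows "Ck_on 2 \<Omega> u"
  unfolding Ck_on_def
proof (intro conjI allI impI)
  fix l :: "'a list"
  show "\<forall>x\<in>\<Omega>. iter_pderiv l u differentiable at x" if "length l < 2"
    using that assms(1,2) by (cases l) auto
  have cont: "continuous_on \<Omega> g" if "\<And>x. x \<in> \<Omega> \<Longrightarrow> g differentiable (at x)" for g
    using that by (auto intro!: differentiable_imp_continuous_on simp: differentiable_on_def differentiable_at_withinI)
  assume "length l \<le> 2"
  then consider "l = []" | i where "l = [i]" | i j where "l = [i, j]"
    by (cases l; cases "tl l") auto
  then show "continuous_on \<Omega> (iter_pderiv l u)"
    using assms(3) cont[OF assms(1)] cont[OF assms(2)] by cases auto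
qed

lemma Ck_on_2_lincomb:
  fixes u v :: "real^'n::finite \<Rightarrow> real"
  assumes "Ck_on 2 \<Omega> u" "Ck_on 2 \<Omega> v" "open \<Omega>"
  shows "Ck_on 2 \<Omega> (\<lambda>x. a * u x + b * v x)"
proof (rule Ck_on_2I)
  fix x i assume x: "x \<in> \<Omega>"
  show "(\<lambda>x. a * u x + b * v x) differentiable (at x)"
    using Ck_on_2D(1)[OF assms(1) x] Ck_on_2D(1)[OF assms(2) x] by simp
  have "(\<lambda>x. a * pderiv_dir i u x + b * pderiv_dir i v x) differentiable (at x)"
    using Ck_on_2D(2)[OF assms(1) x] Ck_on_2D(2)[OF assms(2) x] by simp
  then obtain F where "((\<lambda>x. a * pderiv_dir i u x + b * pderiv_dir i v x) has_derivative F) (at x)"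
    by (auto simp: differentiable_def)
  then have "(pderiv_dir i (\<lambda>x. a * u x + b * v x) has_derivative F) (at x)"
    by (rule has_derivative_transform_within_open[OF _ assms(3) x])
       (simp add: pderiv_dir_lincomb Ck_on_2D(1)[OF assms(1)] Ck_on_2D(1)[OF assms(2)])
  then show "pderiv_dir i (\<lambda>x. a * u x + b * v x) differentiable (at x)"
    by (auto simp: differentiable_def)
next
  fix i j
  have "continuous_on \<Omega> (\<lambda>x. a * pderiv_dir i (pderiv_dir j u) x + b * pderiv_dir i (pderiv_dir j v) x)"
    using Ck_on_2D(3)[OF assms(1)] Ck_on_2D(3)[OF assms(2)] by (intro continuous_intros)
  then show "continuous_on \<Omega> (pderiv_dir i (pderiv_dir j (\<lambda>x. a * u x + b * v x)))"
    using pderiv_dir_lincomb_on[OF assms] by (subst continuous_on_cong[OF refl]) auto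
qed

section \<open>The second order condition at a maximum and the comparison principle\<close>

lemma hessian_nonpos_at_max:
  fixes v :: "real^'n::finite \<Rightarrow> real"
  assumes v: "Ck_on 2 \<Omega> v" and \<Omega>: "open \<Omega>" "x \<in> \<Omega>" and max: "\<And>y. y \<in> \<Omega> \<Longrightarrow> v y \<le> v x"
  shows "\<xi> \<bullet> (hessian v x *v \<xi>) \<le> 0"
proof (rule ccontr)
  assume "\<not> \<xi> \<bullet> (hessian v x *v \<xi>) \<le> 0"
  then have pos: "\<xi> \<bullet> (hessian v x *v \<xi>) > 0" by simp
  define g where "g = (\<lambda>s. v (x + s *\<^sub>R \<xi>))"
  define g' where "g' = (\<lambda>s. \<Sum>i\<in>UNIV. pderiv_dir i v (x + s *\<^sub>R \<xi>) * \<xi> $ i)"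
  obtain r where r: "r > 0" "\<And>s. \<bar>s\<bar> < r \<Longrightarrow> x + s *\<^sub>R \<xi> \<in> \<Omega>"
    using open_line_mem[OF \<Omega>] by blast
  have g: "(g has_real_derivative g' s) (at s)" if "\<bar>s\<bar> < r" for s
    unfolding g_def g'_def using r(2)[OF that] by (intro line_has_real_derivative Ck_on_2D(1)[OF v])
  have "(g' has_real_derivative (\<Sum>i\<in>UNIV. (\<Sum>j\<in>UNIV. pderiv_dir j (pderiv_dir i v) (x + 0 *\<^sub>R \<xi>) * \<xi> $ j) * \<xi> $ i)) (at 0)"
    unfolding g'_def
    by (intro DERIV_sum DERIV_cmult_right line_has_real_derivative Ck_on_2D(2)[OF v]) (use \<Omega>(2) in simp)
  moreover have "(\<Sum>i\<in>UNIV. (\<Sum>j\<in>UNIV. pderiv_dir j (pderiv_dir i v) (x + 0 *\<^sub>R \<xi>) * \<xi> $ j) * \<xi> $ i)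
      = \<xi> \<bullet> (hessian v x *v \<xi>)"
    unfolding inner_vec_def matrix_vector_mult_def hessian_def
    by (simp add: sum_distrib_left sum_distrib_right pderiv_dir_commute[OF v \<Omega>] mult_ac)
  ultimately have "(g' has_real_derivative \<xi> \<bullet> (hessian v x *v \<xi>)) (at 0)" by simp
  \<comment> \<open>As \<open>g'\<close> vanishes at 0 and increases there, it is positive just to
    the right, and the mean value theorem pushes \<open>g\<close> above its maximum.\<close>
  from DERIV_pos_inc_right[OF this pos]
  obtain d where d: "d > 0" "\<And>h. 0 < h \<Longrightarrow> h < d \<Longrightarrow> g' 0 < g' h" by auto
  have "g' 0 = 0"
  proof (rule DERIV_local_max[OF g r(1)])
    show "\<forall>y. \<bar>0 - y\<bar> < r \<longrightarrow> g y \<le> g 0" using max r(2) by (simp add: g_def)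
  qed (use r in simp)
  define b where "b = min r d / 2"
  have b: "0 < b" "b < r" "b < d" using r d by (auto simp: b_def)
  have "\<exists>z>0. z < b \<and> g b - g 0 = (b - 0) * g' z"
    using b(1) by (rule MVT2) (use b g in auto)
  then obtain z where z: "0 < z" "z < b" "g b - g 0 = b * g' z" by auto
  then have "g b > g 0" using d(2)[of z] b \<open>g' 0 = 0\<close> by (smt (verit) mult_pos_pos)
  moreover have "g b \<le> g 0" using max r(2)[of b] b by (simp add: g_def)
  ultimately show False by simp
qed

text \<open>At a positive maximum of \<open>u1 - u2\<close>, necessarily interior, the Hessian of
  \<open>u1\<close> is below that of \<open>u2\<close>, and \<open>minor_sum_mono\<close>
  contradicts the strict inequality. Admissibility is required of \<open>u1\<close> alone, so
  \<open>u2\<close> may be the supersolution barrier.\<close>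

lemma hessian_comparison:
  fixes u1 u2 :: "real^'n::finite \<Rightarrow> real"
  assumes \<Omega>: "open \<Omega>" "bounded \<Omega>"
    and C2: "Ck_on 2 \<Omega> u1" "Ck_on 2 \<Omega> u2"
    and cont: "continuous_on (closure \<Omega>) u1" "continuous_on (closure \<Omega>) u2"
    and adm: "\<And>x j. x \<in> \<Omega> \<Longrightarrow> 1 \<le> j \<Longrightarrow> j \<le> k \<Longrightarrow> 0 < sigma j (hessian u1 x)"
    and less: "\<And>x. x \<in> \<Omega> \<Longrightarrow> sigma k (hessian u2 x) < sigma k (hessian u1 x)"
    and bdry: "\<And>x. x \<in> frontier \<Omega> \<Longrightarrow> u1 x \<le> u2 x"
    and x: "x \<in> \<Omega>"
  shows "u1 x \<le> u2 x"
proof (rule ccontr)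
  assume neg: "\<not> u1 x \<le> u2 x"
  define v where "v = (\<lambda>x. 1 * u1 x + (-1) * u2 x)"
  have vC2: "Ck_on 2 \<Omega> v" unfolding v_def by (rule Ck_on_2_lincomb[OF C2 \<Omega>(1)])
  have "compact (closure \<Omega>)" using \<Omega>(2) by simp
  moreover have "closure \<Omega> \<noteq> {}" using x by auto
  moreover have "continuous_on (closure \<Omega>) v" unfolding v_def using cont by (intro continuous_intros)
  ultimately obtain y where y: "y \<in> closure \<Omega>" and max: "\<And>z. z \<in> closure \<Omega> \<Longrightarrow> v z \<le> v y"
    using continuous_attains_sup by metis
  have "v y > 0" using max[of x] closure_subset x neg by (force simp: v_def)
  then have "y \<notin> frontier \<Omega>" using bdry[of y] by (auto simp: v_def)
  then have yO: "y \<in> \<Omega>" using y \<Omega>(1) by (simp add: frontier_def interior_open)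
  let ?A = "hessian u1 y" and ?B = "hessian u2 y"
  have sym: "transpose ?A = ?A" "transpose ?B = ?B" using transpose_hessian C2 \<Omega>(1) yO by blast+
  have H: "hessian v y = 1 *\<^sub>R ?A + (-1) *\<^sub>R ?B"
    unfolding v_def by (rule hessian_lincomb[OF C2 \<Omega>(1) yO])
  have le: "\<xi> \<bullet> (?A *v \<xi>) \<le> \<xi> \<bullet> (?B *v \<xi>)" for \<xi>
  proof -
    have "\<xi> \<bullet> (hessian v y *v \<xi>) \<le> 0"
      by (rule hessian_nonpos_at_max[OF vC2 \<Omega>(1) yO]) (use max closure_subset in blast)
    then show ?thesis unfolding H by (simp add: matrix_vector_mult_diff_rdistrib inner_diff_right)
  qed
  have "minor_sum k ?A \<le> minor_sum k ?B"
  proof (rule minor_sum_mono[OF sym le])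
    show "0 < minor_sum j ?A" if "j \<le> k" for j
      using adm[OF yO _ that] sigma_symmetric[OF sym(1), of j] by (cases j) auto
  qed simp
  then show False using less[OF yO] sigma_symmetric[OF sym(1)] sigma_symmetric[OF sym(2)] by simp
qed

section \<open>Quadratic functions\<close>

text \<open>A class closed under partial derivatives, affine functions being the case
  \<open>M = 0\<close>; smoothness of \<open>phi E\<close> to all orders follows from first order
  differentiability of its members.\<close>

definition quad :: "real^'n^'n \<Rightarrow> real^'n \<Rightarrow> real \<Rightarrow> real^'n::finite \<Rightarrow> real" where
  "quad M b c = (\<lambda>x. x \<bullet> (M *v x) + b \<bullet> x + c)"

lemma quad_has_derivative:
  "(quad M b c has_derivative (\<lambda>h. h \<bullet> (M *v x) + x \<bullet> (M *v h) + b \<bullet> h)) (at x)"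
proof -
  have "((*v) M has_derivative (*v) M) (at x)"
    using matrix_vector_mul_bounded_linear[of M] by (rule bounded_linear_imp_has_derivative)
  then show ?thesis unfolding quad_def by (auto intro!: derivative_eq_intros)
qed

lemma pderiv_dir_quad:
  "pderiv_dir i (quad M b c) = quad 0 (transpose M *v axis i 1 + M *v axis i 1) (b \<bullet> axis i 1)"
proof
  fix x
  have "pderiv_dir i (quad M b c) x = axis i 1 \<bullet> (M *v x) + x \<bullet> (M *v axis i 1) + b \<bullet> axis i 1"
    by (rule pderiv_dir_eqI[OF quad_has_derivative])
  moreover have "axis i 1 \<bullet> (M *v x) = (transpose M *v axis i 1) \<bullet> x"
    by (simp add: dot_lmul_matrix)
  ultimately show "pderiv_dir i (quad M b c) x = quad 0 (transpose M *v axis i 1 + M *v axis i 1) (b \<bullet> axis i 1) x"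
    by (simp add: quad_def inner_add_left inner_add_right inner_commute)
qed

lemma iter_pderiv_quad: "\<exists>M' b' c'. iter_pderiv l (quad M b c) = quad M' b' c'"
proof (induction l)
  case (Cons i l)
  then show ?case using pderiv_dir_quad by (metis iter_pderiv.simps(2))
qed auto

lemma smooth_on_quad: "smooth_on U (quad M b c)"
proof -
  have "quad M b c differentiable (at x)" for M b c and x :: "real^'n"
    unfolding differentiable_def using quad_has_derivative by blast
  then have "iter_pderiv l (quad M b c) differentiable (at x)" for l x
    using iter_pderiv_quad[of l M b c] by metis
  then show ?thesis
    unfolding smooth_on_def Ck_on_def
    by (auto intro!: differentiable_imp_continuous_on simp: differentiable_on_def differentiable_at_withinI)
qed

lemma hessian_quad:
  fixes M :: "real^'n^'n::finite"
  shows "hessian (quad M b c) x = M + transpose M"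
proof -
  have "transpose (0 :: real^'n^'n) = 0" by (simp add: transpose_def vec_eq_iff)
  moreover have "(0 :: real^'n^'n) *v y = 0" for y by simp
  ultimately show ?thesis
    unfolding hessian_def pderiv_dir_quad
    by (simp only: add_0_left) (simp add: quad_def vec_eq_iff transpose_def inner_axis matrix_vector_mult_basis column_def add.commute)
qed

lemma phi_eq_quad:
  assumes "subspace E"
  shows "phi E = quad ((1/2) *\<^sub>R matrix (orth_proj E)) 0 0"
proof
  fix x
  have "orth_proj E x \<bullet> orth_proj E x = x \<bullet> orth_proj E x"
    using orth_proj_selfadjoint[OF assms, of x "orth_proj E x"] orth_proj_fix[OF assms] orth_proj_works[OF assms]
    by metis
  then show "phi E x = quad ((1/2) *\<^sub>R matrix (orth_proj E)) 0 0 x"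
    by (simp add: phi_def quad_def power2_norm_eq_inner matrix_orth_proj[OF assms] scaleR_matrix_vector_assoc[symmetric])
qed

lemma hessian_phi:
  assumes "subspace E"
  shows "hessian (phi E) x = matrix (orth_proj E)"
proof -
  have "hessian (phi E) x $ i $ j = matrix (orth_proj E) $ i $ j" for i j
    using transpose_matrix_orth_proj[OF assms] unfolding phi_eq_quad[OF assms] hessian_quad
    by (simp add: transpose_def vec_eq_iff)
  then show ?thesis by (simp add: vec_eq_iff)
qed

section \<open>The outward normal and one-sided normal derivatives\<close>

text \<open>The sign of the derivative of \<open>\<rho>\<close> along the ray decides the sign of
  \<open>\<rho>\<close> just after \<open>p\<close>. The conclusions mention \<open>\<Omega>\<close>
  only, which allows different defining functions to be compared.\<close>

lemma local_defining_function_sides: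
  fixes \<Omega> :: "(real^'n::finite) set"
  assumes ldf: "local_defining_function \<Omega> p U \<rho>" and p: "p \<in> frontier \<Omega>"
  shows "gradient \<rho> p \<bullet> d < 0 \<Longrightarrow> \<exists>\<delta>>0. \<forall>s. 0 < s \<longrightarrow> s < \<delta> \<longrightarrow> p + s *\<^sub>R d \<in> \<Omega>"
    and "gradient \<rho> p \<bullet> d > 0 \<Longrightarrow> \<exists>\<delta>>0. \<forall>s. 0 < s \<longrightarrow> s < \<delta> \<longrightarrow> p + s *\<^sub>R d \<notin> \<Omega>"
proof -
  have U: "open U" "p \<in> U" "smooth_on U \<rho>" "\<Omega> \<inter> U = {x \<in> U. \<rho> x < 0}" "frontier \<Omega> \<inter> U = {x \<in> U. \<rho> x = 0}"
    using ldf by (auto simp: local_defining_function_def)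
  have zero: "\<rho> p = 0" using U p by blast
  have "Ck_on 2 U \<rho>" using U(3) by (simp add: smooth_on_def)
  then have "\<rho> differentiable (at (p + 0 *\<^sub>R d))" using Ck_on_2D(1) U(2) by force
  from line_has_real_derivative[OF this]
  have der: "((\<lambda>s. \<rho> (p + s *\<^sub>R d)) has_real_derivative gradient \<rho> p \<bullet> d) (at 0)"
    by (simp add: gradient_def inner_vec_def)
  obtain r where r: "r > 0" "\<And>s. \<bar>s\<bar> < r \<Longrightarrow> p + s *\<^sub>R d \<in> U"
    using open_line_mem[OF U(1,2)] by blast
  {
    assume "gradient \<rho> p \<bullet> d < 0"
    from DERIV_neg_dec_right[OF der this] obtain e where
      "e > 0" "\<And>h. 0 < h \<Longrightarrow> h < e \<Longrightarrow> \<rho> (p + h *\<^sub>R d) < 0" using zero by auto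
    then show "\<exists>\<delta>>0. \<forall>s. 0 < s \<longrightarrow> s < \<delta> \<longrightarrow> p + s *\<^sub>R d \<in> \<Omega>"
      using r U(4) by (intro exI[of _ "min r e"]) auto
  next
    assume "gradient \<rho> p \<bullet> d > 0"
    from DERIV_pos_inc_right[OF der this] obtain e where
      e: "e > 0" "\<And>h. 0 < h \<Longrightarrow> h < e \<Longrightarrow> \<rho> (p + h *\<^sub>R d) > 0" using zero by auto
    have "p + s *\<^sub>R d \<notin> \<Omega>" if s: "0 < s" "s < min r e" for s
    proof
      assume "p + s *\<^sub>R d \<in> \<Omega>"
      moreover have "p + s *\<^sub>R d \<in> U" using r(2)[of s] s by simp
      ultimately have "\<rho> (p + s *\<^sub>R d) < 0" using U(4) by blast
      then show False using e(2)[of s] s by simp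
    qed
    then show "\<exists>\<delta>>0. \<forall>s. 0 < s \<longrightarrow> s < \<delta> \<longrightarrow> p + s *\<^sub>R d \<notin> \<Omega>"
      using r(1) e(1) by (intro exI[of _ "min r e"]) auto
  }
qed

text \<open>Two different unit normals would be separated by the direction \<open>n\<^sub>2 - n\<^sub>1\<close>, which would point
  into \<open>\<Omega>\<close> and out of it at the same time.\<close>

lemma outward_normal_eq:
  fixes \<Omega> :: "(real^'n::finite) set"
  assumes ldf: "local_defining_function \<Omega> p U \<rho>" and p: "p \<in> frontier \<Omega>"
  shows "outward_normal \<Omega> p = gradient \<rho> p /\<^sub>R norm (gradient \<rho> p)"
proof -
  let ?n = "\<lambda>\<rho>. gradient \<rho> p /\<^sub>R norm (gradient \<rho> p)"
  have unique: "?n \<rho>1 = ?n \<rho>2"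
    if 1: "local_defining_function \<Omega> p U1 \<rho>1" and 2: "local_defining_function \<Omega> p U2 \<rho>2" for U1 \<rho>1 U2 \<rho>2
  proof (rule ccontr)
    assume ne: "?n \<rho>1 \<noteq> ?n \<rho>2"
    have nz: "gradient \<rho>1 p \<noteq> 0" "gradient \<rho>2 p \<noteq> 0"
      using 1 2 by (auto simp: local_defining_function_def)
    define a where "a = ?n \<rho>1"
    define b where "b = ?n \<rho>2"
    have ab: "a \<bullet> a = 1" "b \<bullet> b = 1"
      using nz by (simp_all add: a_def b_def dot_square_norm power2_eq_square)
    have "(a - b) \<bullet> (a - b) > 0" using ne by (simp add: a_def b_def)
    then have lt: "a \<bullet> b < 1" using ab by (simp add: inner_diff_left inner_diff_right inner_commute)
    let ?d = "b - a"
    have g: "gradient \<rho>1 p = norm (gradient \<rho>1 p) *\<^sub>R a" "gradient \<rho>2 p = norm (gradient \<rho>2 p) *\<^sub>R b"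
      using nz by (simp_all add: a_def b_def)
    have "a \<bullet> ?d < 0" "b \<bullet> ?d > 0" using ab lt by (auto simp: inner_diff_right inner_commute)
    then have "gradient \<rho>1 p \<bullet> ?d < 0" "gradient \<rho>2 p \<bullet> ?d > 0"
      using nz by (subst g, simp add: mult_pos_neg)+
    then obtain \<delta>1 \<delta>2 where \<delta>: "\<delta>1 > 0" "\<And>s. 0 < s \<Longrightarrow> s < \<delta>1 \<Longrightarrow> p + s *\<^sub>R ?d \<in> \<Omega>"
      "\<delta>2 > 0" "\<And>s. 0 < s \<Longrightarrow> s < \<delta>2 \<Longrightarrow> p + s *\<^sub>R ?d \<notin> \<Omega>"
      using local_defining_function_sides(1)[OF 1 p] local_defining_function_sides(2)[OF 2 p] by meson
    define s where "s = min \<delta>1 \<delta>2 / 2"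
    have "0 < s" "s < \<delta>1" "s < \<delta>2" using \<delta>(1,3) by (auto simp: s_def)
    then show False using \<delta>(2,4) by blast
  qed
  show ?thesis unfolding outward_normal_def
    by (rule the_equality) (use ldf unique in blast)+
qed

lemma outward_normal_props:
  fixes \<Omega> :: "(real^'n::finite) set"
  assumes "smooth_bounded_domain \<Omega>" and p: "p \<in> frontier \<Omega>"
  shows "norm (outward_normal \<Omega> p) = 1"
    and "\<exists>\<delta>>0. \<forall>s. - \<delta> < s \<longrightarrow> s < 0 \<longrightarrow> p + s *\<^sub>R outward_normal \<Omega> p \<in> \<Omega>"
proof -
  obtain U \<rho> where ldf: "local_defining_function \<Omega> p U \<rho>"
    using assms unfolding smooth_bounded_domain_def by blast
  then have nz: "gradient \<rho> p \<noteq> 0" by (auto simp: local_defining_function_def)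
  let ?\<nu> = "outward_normal \<Omega> p"
  have \<nu>: "?\<nu> = gradient \<rho> p /\<^sub>R norm (gradient \<rho> p)" by (rule outward_normal_eq[OF ldf p])
  show "norm ?\<nu> = 1" using nz by (simp add: \<nu>)
  have "gradient \<rho> p \<bullet> (- ?\<nu>) < 0" using nz by (simp add: \<nu>)
  from local_defining_function_sides(1)[OF ldf p this]
  obtain \<delta> where \<delta>: "\<delta> > 0" "\<And>s. 0 < s \<Longrightarrow> s < \<delta> \<Longrightarrow> p + s *\<^sub>R (- ?\<nu>) \<in> \<Omega>" by auto
  have "p + s *\<^sub>R ?\<nu> \<in> \<Omega>" if "- \<delta> < s" "s < 0" for s using \<delta>(2)[of "- s"] that by simp
  then show "\<exists>\<delta>>0. \<forall>s. - \<delta> < s \<longrightarrow> s < 0 \<longrightarrow> p + s *\<^sub>R ?\<nu> \<in> \<Omega>" using \<delta>(1) by blast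
qed

lemma normal_derivative_eqI:
  "((\<lambda>s. u (x + s *\<^sub>R outward_normal \<Omega> x)) has_real_derivative D) (at_left 0) \<Longrightarrow> normal_derivative \<Omega> u x = D"
  unfolding normal_derivative_def has_real_derivative_iff_has_vector_derivative
  by (rule vector_derivative_within) auto

text \<open>Derivatives of \<open>u\<close> are available only inside \<open>\<Omega>\<close>.
  L'Hopital's rule along the inward normal turns the limit of these, given by continuous extensions
  \<open>v i\<close>, into a one-sided derivative at the boundary point.\<close>

lemma smooth_on_closure_normal_derivative:
  fixes u :: "real^'n::finite \<Rightarrow> real"
  assumes \<Omega>: "smooth_bounded_domain \<Omega>" and u: "smooth_on_closure \<Omega> u"
  obtains v where "\<And>i. continuous_on (closure \<Omega>) (v i)"
    "\<And>p. p \<in> frontier \<Omega> \<Longrightarrow> ((\<lambda>s. u (p + s *\<^sub>R outward_normal \<Omega> p))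
        has_real_derivative (\<Sum>i\<in>UNIV. v i p * outward_normal \<Omega> p $ i)) (at_left 0)"
proof -
  have "\<exists>v. continuous_on (closure \<Omega>) v \<and> (\<forall>x\<in>\<Omega>. v x = pderiv_dir i u x)" for i
  proof -
    have "\<exists>v. continuous_on (closure \<Omega>) v \<and> (\<forall>x\<in>\<Omega>. v x = iter_pderiv [i] u x)"
      using u unfolding smooth_on_closure_def by blast
    then show ?thesis by simp
  qed
  then obtain v where v: "\<And>i. continuous_on (closure \<Omega>) (v i)" "\<And>i x. x \<in> \<Omega> \<Longrightarrow> v i x = pderiv_dir i u x"
    by metis
  have cu: "continuous_on (closure \<Omega>) u" and C2: "Ck_on 2 \<Omega> u"
    using u by (auto simp: smooth_on_closure_def smooth_on_def)
  show ?thesis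
  proof (rule that[OF v(1)])
    fix p assume p: "p \<in> frontier \<Omega>"
    let ?\<nu> = "outward_normal \<Omega> p"
    let ?l = "\<lambda>s. p + s *\<^sub>R ?\<nu>"
    obtain \<delta> where \<delta>: "\<delta> > 0" "\<And>s. - \<delta> < s \<Longrightarrow> s < 0 \<Longrightarrow> ?l s \<in> \<Omega>"
      using outward_normal_props(2)[OF \<Omega> p] by auto
    have pc: "p \<in> closure \<Omega>" using p by (simp add: frontier_def)
    have ev: "\<forall>\<^sub>F s in at_left 0. ?l s \<in> \<Omega>"
      using \<delta> by (auto simp: eventually_at_left_field intro!: exI[of _ "- \<delta>"])
    have lim: "((\<lambda>s. f (?l s)) \<longlongrightarrow> f p) (at_left 0)" if "continuous_on (closure \<Omega>) f" for f :: "real^'n \<Rightarrow> real"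
    proof -
      have "(f \<longlongrightarrow> f p) (at p within closure \<Omega>)"
        using that pc by (simp add: continuous_on_def)
      moreover have "filterlim ?l (at p within closure \<Omega>) (at_left 0)"
        unfolding filterlim_at
      proof
        show "\<forall>\<^sub>F s in at_left 0. ?l s \<in> closure \<Omega> \<and> ?l s \<noteq> p"
          using ev
        proof eventually_elim
          case (elim s)
          moreover have "p \<notin> \<Omega>" using p \<Omega> by (simp add: frontier_def smooth_bounded_domain_def interior_open)
          ultimately show ?case using closure_subset by auto
        qed
        have "(?l \<longlongrightarrow> p + 0 *\<^sub>R ?\<nu>) (at_left 0)" by (intro tendsto_intros)
        then show "(?l \<longlongrightarrow> p) (at_left 0)" by simp
      qed
      ultimately show ?thesis by (rule filterlim_compose)
    qed
    have "((\<lambda>s. (u (?l s) - u p) / s) \<longlongrightarrow> (\<Sum>i\<in>UNIV. v i p * ?\<nu> $ i)) (at_left 0)"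
    proof (rule lhopital_left[where g' = "\<lambda>_. 1"])
      show "((\<lambda>s. u (?l s) - u p) \<longlongrightarrow> 0) (at_left 0)"
        using tendsto_diff[OF lim[OF cu] tendsto_const[of "u p"]] by simp
      show "\<forall>\<^sub>F s in at_left 0. ((\<lambda>s. u (?l s) - u p) has_real_derivative (\<Sum>i\<in>UNIV. v i (?l s) * ?\<nu> $ i)) (at s)"
        using ev
      proof eventually_elim
        case (elim s)
        have "((\<lambda>s. u (?l s)) has_real_derivative (\<Sum>i\<in>UNIV. v i (?l s) * ?\<nu> $ i)) (at s)"
          using line_has_real_derivative[OF Ck_on_2D(1)[OF C2 elim]] v(2)[OF elim] by simp
        then show ?case by (auto intro!: derivative_eq_intros)
      qed
      show "((\<lambda>s. (\<Sum>i\<in>UNIV. v i (?l s) * ?\<nu> $ i) / 1) \<longlongrightarrow> (\<Sum>i\<in>UNIV. v i p * ?\<nu> $ i)) (at_left 0)"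
        unfolding div_by_1 by (intro tendsto_intros lim v(1))
    qed (auto simp: eventually_at_left_field intro!: exI[of _ "-1"])
    then show "((\<lambda>s. u (?l s)) has_real_derivative (\<Sum>i\<in>UNIV. v i p * ?\<nu> $ i)) (at_left 0)"
      by (simp add: has_field_derivative_iff)
  qed
qed

text \<open>The order is reversed because the difference quotients are divided by a negative number:
  the lower function has the larger outward derivative.\<close>

lemma left_derivative_le:
  fixes g h :: "real \<Rightarrow> real"
  assumes "(g has_real_derivative a) (at_left 0)" "(h has_real_derivative b) (at_left 0)"
    and "g 0 = h 0" and "\<forall>\<^sub>F s in at_left 0. g s \<le> h s"
  shows "b \<le> a"
proof (rule tendsto_le)
  show "((\<lambda>s. (g s - g 0) / (s - 0)) \<longlongrightarrow> a) (at_left 0)" "((\<lambda>s. (h s - h 0) / (s - 0)) \<longlongrightarrow> b) (at_left 0)"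
    using assms(1,2) by (simp_all add: has_field_derivative_iff)
  have "\<forall>\<^sub>F s in at_left (0::real). s < 0" by (auto simp: eventually_at_left_field intro!: exI[of _ "-1"])
  with assms(4) show "\<forall>\<^sub>F s in at_left 0. (h s - h 0) / (s - 0) \<le> (g s - g 0) / (s - 0)"
    by eventually_elim (use assms(3) in \<open>auto simp: divide_le_cancel\<close>)
qed simp

section \<open>Barriers\<close>

lemma continuous_family_bounded:
  fixes v :: "'i::finite \<Rightarrow> 'a::topological_space \<Rightarrow> real"
  assumes "compact K" "\<And>i. continuous_on K (v i)"
  obtains C where "0 \<le> C" "\<And>i x. x \<in> K \<Longrightarrow> \<bar>v i x\<bar> \<le> C"
proof -
  have "bounded (\<Union>i. v i ` K)"
    using assms by (auto intro!: bounded_UN compact_imp_bounded compact_continuous_image)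
  then obtain C where "\<forall>y\<in>(\<Union>i. v i ` K). \<bar>y\<bar> \<le> C" by (auto simp: bounded_real)
  then have "\<bar>v i x\<bar> \<le> max 0 C" if "x \<in> K" for i x using that by (force simp: le_max_iff_disj)
  then show ?thesis using that[of "max 0 C"] by simp
qed

lemma hessian_bounded:
  fixes w :: "real^'n::finite \<Rightarrow> real"
  assumes "bounded \<Omega>" and w: "smooth_on_closure \<Omega> w"
  obtains C where "0 \<le> C" "\<And>i j x. x \<in> \<Omega> \<Longrightarrow> \<bar>hessian w x $ i $ j\<bar> \<le> C"
proof -
  have "\<exists>v. continuous_on (closure \<Omega>) v \<and> (\<forall>x\<in>\<Omega>. v x = iter_pderiv [fst q, snd q] w x)" for q
    using w unfolding smooth_on_closure_def by blast
  then obtain v where v: "\<And>q. continuous_on (closure \<Omega>) (v q)"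
    "\<And>q x. x \<in> \<Omega> \<Longrightarrow> v q x = iter_pderiv [fst q, snd q] w x" by metis
  obtain C where C: "0 \<le> C" "\<And>q x. x \<in> closure \<Omega> \<Longrightarrow> \<bar>v q x\<bar> \<le> C"
    using continuous_family_bounded[of "closure \<Omega>" v] assms(1) v(1) by auto
  have "\<bar>hessian w x $ i $ j\<bar> \<le> C" if "x \<in> \<Omega>" for i j x
  proof -
    have "hessian w x $ i $ j = v (i, j) x" using v(2)[OF that, of "(i, j)"] by (simp add: hessian_def)
    then show ?thesis using C(2)[of x "(i, j)"] closure_subset that by auto
  qed
  then show ?thesis using that C(1) by blast
qed

text \<open>Pulling \<open>t\<close> out of the Hessian leaves a perturbation of the projection of
  size \<open>1 / t ^ Suc m\<close>. At order \<open>Suc m\<close> the prefactor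
  \<open>t ^ Suc m\<close> cancels this size in the leading term; at lower orders positivity
  suffices.\<close>

lemma barrier_sigma:
  fixes \<Omega> E :: "(real^'n::finite) set"
  assumes \<Omega>: "open \<Omega>" "bounded \<Omega>" and E: "subspace E" "dim E = m"
    and w: "smooth_on_closure \<Omega> w" and lap: "\<And>x. x \<in> \<Omega> \<Longrightarrow> laplacian_along (orthogonal_comp E) w x = f x"
  obtains K where "0 \<le> K"
    "\<And>t a x. 1 \<le> t \<Longrightarrow> 0 \<le> a \<Longrightarrow> a \<le> 2 \<Longrightarrow> x \<in> \<Omega> \<Longrightarrow>
       \<bar>sigma (Suc m) (hessian (\<lambda>y. t * phi E y + a / t ^ m * w y) x) - a * f x\<bar> \<le> K / t"
    "\<And>t a x j. 1 \<le> t \<Longrightarrow> 0 \<le> a \<Longrightarrow> a \<le> 2 \<Longrightarrow> x \<in> \<Omega> \<Longrightarrow> j \<le> m \<Longrightarrow> K / t < 1 \<Longrightarrow>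
       0 < sigma j (hessian (\<lambda>y. t * phi E y + a / t ^ m * w y) x)"
proof -
  let ?P = "matrix (orth_proj E)"
  let ?\<psi> = "\<lambda>t a y. t * phi E y + a / t ^ m * w y"
  obtain C where C: "0 \<le> C" "\<And>i j x. x \<in> \<Omega> \<Longrightarrow> \<bar>hessian w x $ i $ j\<bar> \<le> C"
    using hessian_bounded[OF \<Omega>(2) w] by blast
  \<comment> \<open>The perturbing matrix is \<open>a\<close> times the Hessian of \<open>w\<close>
    with \<open>a \<le> 2\<close>, hence the factor 2.\<close>
  have "0 \<le> 2 * C" using C by simp
  from minor_sum_projection_perturbation[OF E this] obtain K where K: "0 \<le> K"
    "\<And>A :: real^'n^'n. \<And>\<epsilon>. (\<And>i j. \<bar>A $ i $ j\<bar> \<le> 2 * C) \<Longrightarrow> 0 \<le> \<epsilon> \<Longrightarrow> \<epsilon> \<le> 1 \<Longrightarrow>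
       \<bar>minor_sum (Suc m) (?P + \<epsilon> *\<^sub>R A)
          - \<epsilon> * trace (matrix (orth_proj (orthogonal_comp E)) ** A)\<bar> \<le> K * \<epsilon>\<^sup>2"
    "\<And>A :: real^'n^'n. \<And>\<epsilon> j. (\<And>i j. \<bar>A $ i $ j\<bar> \<le> 2 * C) \<Longrightarrow> 0 \<le> \<epsilon> \<Longrightarrow> \<epsilon> \<le> 1 \<Longrightarrow> j \<le> m \<Longrightarrow>
       1 - K * \<epsilon> \<le> minor_sum j (?P + \<epsilon> *\<^sub>R A)" by blast
  have wC: "Ck_on 2 \<Omega> w" using w by (simp add: smooth_on_closure_def smooth_on_def)
  have phiC: "Ck_on 2 \<Omega> (phi E)"
    unfolding phi_eq_quad[OF E(1)] using smooth_on_quad unfolding smooth_on_def by blast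
  have main: "sigma j (hessian (?\<psi> t a) x) = t ^ j * minor_sum j (?P + (1 / t ^ Suc m) *\<^sub>R (a *\<^sub>R hessian w x))"
    if "1 \<le> t" "x \<in> \<Omega>" for t a x j
  proof -
    have "hessian (?\<psi> t a) x = t *\<^sub>R (?P + (1 / t ^ Suc m) *\<^sub>R (a *\<^sub>R hessian w x))"
      using hessian_lincomb[OF phiC wC \<Omega>(1) that(2), of t "a / t ^ m"] that(1)
      by (simp add: hessian_phi[OF E(1)] scaleR_add_right)
    moreover have "transpose (hessian (?\<psi> t a) x) = hessian (?\<psi> t a) x"
      by (rule transpose_hessian[OF Ck_on_2_lincomb[OF phiC wC \<Omega>(1)] \<Omega>(1) that(2)])
    ultimately show ?thesis using sigma_symmetric minor_sum_smult by metis
  qed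
  have bound: "\<bar>(a *\<^sub>R hessian w x) $ i $ j\<bar> \<le> 2 * C" if "0 \<le> a" "a \<le> 2" "x \<in> \<Omega>" for a x i j
    using mult_mono[of a 2 "\<bar>hessian w x $ i $ j\<bar>" C] that C by (simp add: abs_mult)
  \<comment> \<open>The rate \<open>1 / t ^ Suc m\<close> is weakened to \<open>1 / t\<close>, which
    tends to zero and makes the threshold for \<open>t\<close> simple.\<close>
  have eps: "0 \<le> 1 / t ^ Suc m" "1 / t ^ Suc m \<le> 1" "K * (1 / t ^ Suc m) \<le> K / t" if "1 \<le> t" for t :: real
  proof -
    show "0 \<le> 1 / t ^ Suc m" using that by simp
    have "1 \<le> t ^ Suc m" using that by (rule one_le_power)
    then show "1 / t ^ Suc m \<le> 1" by (simp add: divide_le_eq_1)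
    have "t ^ 1 \<le> t ^ Suc m" using that by (intro power_increasing) auto
    then have "K / t ^ Suc m \<le> K / t" using that K(1) by (intro divide_left_mono) auto
    then show "K * (1 / t ^ Suc m) \<le> K / t" by simp
  qed
  show ?thesis
  proof (rule that[OF K(1)])
    fix t a :: real and x assume t: "1 \<le> t" and a: "0 \<le> a" "a \<le> 2" and x: "x \<in> \<Omega>"
    let ?\<epsilon> = "1 / t ^ Suc m" and ?A = "a *\<^sub>R hessian w x"
    have tr: "trace (matrix (orth_proj (orthogonal_comp E)) ** ?A) = a * f x"
      by (simp add: lap[OF x, symmetric] laplacian_along_def trace_def matrix_matrix_mult_def sum_distrib_left mult_ac)
    have te: "t ^ Suc m * ?\<epsilon> = 1" using t by simp
    have "\<bar>minor_sum (Suc m) (?P + ?\<epsilon> *\<^sub>R ?A) - ?\<epsilon> * (a * f x)\<bar> \<le> K * ?\<epsilon>\<^sup>2"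
      using K(2)[of ?A ?\<epsilon>, OF bound[OF a x] eps(1,2)[OF t]] unfolding tr .
    then have "t ^ Suc m * \<bar>minor_sum (Suc m) (?P + ?\<epsilon> *\<^sub>R ?A) - ?\<epsilon> * (a * f x)\<bar> \<le> t ^ Suc m * (K * ?\<epsilon>\<^sup>2)"
      using t by (intro mult_left_mono) auto
    also have "t ^ Suc m * (K * ?\<epsilon>\<^sup>2) = (t ^ Suc m * ?\<epsilon>) * (K * ?\<epsilon>)" by (simp only: power2_eq_square mult_ac)
    also have "\<dots> \<le> K / t" using te eps(3)[OF t] by simp
    also have "t ^ Suc m * \<bar>minor_sum (Suc m) (?P + ?\<epsilon> *\<^sub>R ?A) - ?\<epsilon> * (a * f x)\<bar>
        = \<bar>t ^ Suc m * (minor_sum (Suc m) (?P + ?\<epsilon> *\<^sub>R ?A) - ?\<epsilon> * (a * f x))\<bar>"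
      using t by (simp only: abs_mult) simp
    also have "t ^ Suc m * (minor_sum (Suc m) (?P + ?\<epsilon> *\<^sub>R ?A) - ?\<epsilon> * (a * f x))
        = t ^ Suc m * minor_sum (Suc m) (?P + ?\<epsilon> *\<^sub>R ?A) - (t ^ Suc m * ?\<epsilon>) * (a * f x)"
      by (simp only: right_diff_distrib mult.assoc)
    finally show "\<bar>sigma (Suc m) (hessian (?\<psi> t a) x) - a * f x\<bar> \<le> K / t"
      unfolding main[OF t x] te by simp
  next
    fix t a :: real and x j assume t: "1 \<le> t" and a: "0 \<le> a" "a \<le> 2" and x: "x \<in> \<Omega>" and j: "j \<le> m" and Kt: "K / t < 1"
    have "0 < minor_sum j (?P + (1 / t ^ Suc m) *\<^sub>R (a *\<^sub>R hessian w x))"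
      using K(3)[of "a *\<^sub>R hessian w x" "1 / t ^ Suc m" j, OF bound[OF a x] eps(1,2)[OF t] j] eps(3)[OF t] Kt
      by linarith
    then show "0 < sigma j (hessian (?\<psi> t a) x)" using t unfolding main[OF t x] by simp
  qed
qed

section \<open>Squeezing the normal derivative between those of the barriers\<close>

theorem corollary4p6:
  fixes \<Omega> E V :: "(real^'n::finite) set"
    and f w :: "real^'n \<Rightarrow> real"
    and \<Lambda> :: "(real^'n \<Rightarrow> real) \<Rightarrow> real^'n \<Rightarrow> real"
    and c\<^sub>0 :: real and k :: nat
  assumes "2 \<le> k" and "k \<le> CARD('n)"
    and "smooth_bounded_domain \<Omega>" and "uniformly_convex \<Omega>"
    and "smooth_on_closure \<Omega> f" and "0 < c\<^sub>0" and "\<forall>x\<in>closure \<Omega>. c\<^sub>0 \<le> f x"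
    and "is_dirichlet_to_neumann k \<Omega> f \<Lambda>"
    and "subspace E" and "dim E = k - 1" and "V = orthogonal_comp E"
    and "fiberwise_poisson_correction \<Omega> V f w"
  shows "locally_uniform_limit (nontangential_boundary \<Omega> V)
           (\<lambda>t x. t ^ (k - 1) *
              (\<Lambda> (\<lambda>y. t * phi E y) x - t * normal_derivative \<Omega> (phi E) x))
           (\<lambda>x. normal_derivative \<Omega> w x) at_top"
proof -
  note dom = assms(3) and E = assms(9)
  have \<Omega>: "open \<Omega>" "bounded \<Omega>" using dom by (auto simp: smooth_bounded_domain_def)
  obtain m where k: "k = Suc m" using assms(1) by (cases k) auto
  then have dimE: "dim E = m" using assms(10) by simp
  have w: "smooth_on_closure \<Omega> w" and lap: "\<And>x. x \<in> \<Omega> \<Longrightarrow> laplacian_along (orthogonal_comp E) w x = f x"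
    and w0: "\<And>x. x \<in> frontier \<Omega> \<Longrightarrow> w x = 0"
    using assms(11,12) by (auto simp: fiberwise_poisson_correction_def)
  have wC: "Ck_on 2 \<Omega> w" and wcont: "continuous_on (closure \<Omega>) w"
    using w by (auto simp: smooth_on_closure_def smooth_on_def)
  have phi_smooth: "smooth_on U (phi E)" for U
    unfolding phi_eq_quad[OF E] by (rule smooth_on_quad)
  have phiC: "Ck_on 2 \<Omega> (phi E)" using phi_smooth by (simp add: smooth_on_def)
  have phicont: "continuous_on S (phi E)" for S
  proof -
    have "Ck_on 0 S (phi E)" using phi_smooth by (simp add: smooth_on_def)
    then show ?thesis unfolding Ck_on_def by (metis iter_pderiv.simps(1) le0 list.size(3))
  qed
  have phi_deriv: "((\<lambda>s. phi E (x + s *\<^sub>R outward_normal \<Omega> x))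
      has_real_derivative normal_derivative \<Omega> (phi E) x) (at_left 0)" for x
  proof -
    have "phi E differentiable (at (x + 0 *\<^sub>R outward_normal \<Omega> x))"
      unfolding phi_eq_quad[OF E] differentiable_def using quad_has_derivative by blast
    from line_has_real_derivative[OF this]
    have "\<exists>D. ((\<lambda>s. phi E (x + s *\<^sub>R outward_normal \<Omega> x)) has_real_derivative D) (at_left 0)"
      using has_field_derivative_at_within by blast
    then show ?thesis using normal_derivative_eqI by metis
  qed
  obtain v where v: "\<And>i. continuous_on (closure \<Omega>) (v i)"
    and w_deriv: "\<And>p. p \<in> frontier \<Omega> \<Longrightarrow> ((\<lambda>s. w (p + s *\<^sub>R outward_normal \<Omega> p))
        has_real_derivative (\<Sum>i\<in>UNIV. v i p * outward_normal \<Omega> p $ i)) (at_left 0)"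
    using smooth_on_closure_normal_derivative[OF dom w] by blast
  let ?Dw = "\<lambda>p. \<Sum>i\<in>UNIV. v i p * outward_normal \<Omega> p $ i"
  have Dw: "normal_derivative \<Omega> w p = ?Dw p" if "p \<in> frontier \<Omega>" for p
    by (rule normal_derivative_eqI[OF w_deriv[OF that]])
  have "compact (closure \<Omega>)" using \<Omega>(2) by simp
  then obtain C where C: "0 \<le> C" "\<And>i x. x \<in> closure \<Omega> \<Longrightarrow> \<bar>v i x\<bar> \<le> C"
    using continuous_family_bounded[of "closure \<Omega>" v] v by blast
  define C1 where "C1 = real CARD('n) * C"
  have C1: "0 \<le> C1" using C by (simp add: C1_def)
  have Dw_bound: "\<bar>?Dw p\<bar> \<le> C1" if "p \<in> frontier \<Omega>" for p
  proof -
    have "\<bar>?Dw p\<bar> \<le> (\<Sum>i\<in>(UNIV :: 'n set). C * 1)"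
    proof (rule order_trans[OF sum_abs sum_mono])
      fix i
      have "\<bar>outward_normal \<Omega> p $ i\<bar> \<le> 1"
        using component_le_norm_cart[of "outward_normal \<Omega> p" i] outward_normal_props(1)[OF dom that] by simp
      moreover have "\<bar>v i p\<bar> \<le> C" using C(2) that by (simp add: frontier_def)
      ultimately show "\<bar>v i p * outward_normal \<Omega> p $ i\<bar> \<le> C * 1"
        unfolding abs_mult using C(1) by (intro mult_mono) auto
    qed
    then show ?thesis by (simp add: C1_def)
  qed
  obtain K where K: "0 \<le> K"
    "\<And>t a x. 1 \<le> t \<Longrightarrow> 0 \<le> a \<Longrightarrow> a \<le> 2 \<Longrightarrow> x \<in> \<Omega> \<Longrightarrow>
       \<bar>sigma (Suc m) (hessian (\<lambda>y. t * phi E y + a / t ^ m * w y) x) - a * f x\<bar> \<le> K / t"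
    "\<And>t a x j. 1 \<le> t \<Longrightarrow> 0 \<le> a \<Longrightarrow> a \<le> 2 \<Longrightarrow> x \<in> \<Omega> \<Longrightarrow> j \<le> m \<Longrightarrow> K / t < 1 \<Longrightarrow>
       0 < sigma j (hessian (\<lambda>y. t * phi E y + a / t ^ m * w y) x)"
    using barrier_sigma[OF \<Omega> E dimE w lap] by blast
  \<comment> \<open>\<open>K / t < 1\<close> gives the lower barrier positive lower order symmetric
    functions, and \<open>K / t < \<eta> * c\<^sub>0\<close> makes both barriers strict. The bound
    does not depend on \<open>x\<close>.\<close>
  have estimate: "\<bar>t ^ m * (\<Lambda> (\<lambda>y. t * phi E y) x - t * normal_derivative \<Omega> (phi E) x)
      - normal_derivative \<Omega> w x\<bar> \<le> \<eta> * C1"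
    if t: "1 \<le> t" "K / t < 1" "K / t < \<eta> * c\<^sub>0" and \<eta>: "0 < \<eta>" "\<eta> \<le> 1" and x: "x \<in> frontier \<Omega>" for t \<eta> x
  proof -
    let ?g = "\<lambda>y. t * phi E y"
    have "smooth_on UNIV ?g"
    proof -
      have "?g = quad (t *\<^sub>R ((1/2) *\<^sub>R matrix (orth_proj E))) 0 0"
        unfolding phi_eq_quad[OF E] by (simp add: quad_def fun_eq_iff scaleR_matrix_vector_assoc[symmetric])
      then show ?thesis using smooth_on_quad by metis
    qed
    then have "smooth_on_subset (frontier \<Omega>) ?g"
      unfolding smooth_on_subset_def using open_UNIV by blast
    then obtain u where sol: "hessian_dirichlet_solution k \<Omega> f ?g u"
      and \<Lambda>: "\<And>x. x \<in> frontier \<Omega> \<Longrightarrow> \<Lambda> ?g x = normal_derivative \<Omega> u x"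
      using assms(8) unfolding is_dirichlet_to_neumann_def by blast
    have u: "smooth_on_closure \<Omega> u" "Ck_on 2 \<Omega> u" "continuous_on (closure \<Omega>) u"
      and u_adm: "\<And>x j. x \<in> \<Omega> \<Longrightarrow> 1 \<le> j \<Longrightarrow> j \<le> k \<Longrightarrow> 0 < sigma j (hessian u x)"
      and u_eq: "\<And>x. x \<in> \<Omega> \<Longrightarrow> sigma k (hessian u x) = f x"
      and u_bdry: "\<And>x. x \<in> frontier \<Omega> \<Longrightarrow> u x = ?g x"
      using sol by (auto simp: hessian_dirichlet_solution_def k_admissible_def smooth_on_closure_def
          Gamma_cone_def sigma_def)
    define b where "b = (\<lambda>a y. t * phi E y + a / t ^ m * w y)"
    have bC: "Ck_on 2 \<Omega> (b a)" for a
      unfolding b_def by (rule Ck_on_2_lincomb[OF phiC wC \<Omega>(1)])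
    have bcont: "continuous_on (closure \<Omega>) (b a)" for a
      unfolding b_def using phicont wcont by (intro continuous_intros)
    have b_bdry: "b a x = ?g x" if "x \<in> frontier \<Omega>" for a x
      using w0[OF that] by (simp add: b_def)
    have f: "c\<^sub>0 \<le> f y" if "y \<in> \<Omega>" for y using assms(7) closure_subset that by blast
    \<comment> \<open>The error \<open>K / t\<close> is smaller than the surplus
      \<open>\<eta> f\<close>, which is at least \<open>\<eta> c\<^sub>0\<close>.\<close>
    have sub: "f y < sigma k (hessian (b (1 + \<eta>)) y)" if "y \<in> \<Omega>" for y
    proof -
      have "\<bar>sigma k (hessian (b (1 + \<eta>)) y) - (1 + \<eta>) * f y\<bar> \<le> K / t"
        unfolding b_def k by (rule K(2)) (use t \<eta> that in auto)
      moreover have "\<eta> * c\<^sub>0 \<le> \<eta> * f y" using f[OF that] \<eta> by (intro mult_left_mono) auto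
      ultimately show ?thesis using t(3) by (simp add: algebra_simps abs_le_iff)
    qed
    have sup: "sigma k (hessian (b (1 - \<eta>)) y) < f y" if "y \<in> \<Omega>" for y
    proof -
      have "\<bar>sigma k (hessian (b (1 - \<eta>)) y) - (1 - \<eta>) * f y\<bar> \<le> K / t"
        unfolding b_def k by (rule K(2)) (use t \<eta> that in auto)
      moreover have "\<eta> * c\<^sub>0 \<le> \<eta> * f y" using f[OF that] \<eta> by (intro mult_left_mono) auto
      ultimately show ?thesis using t(3) by (simp add: algebra_simps abs_le_iff)
    qed
    \<comment> \<open>The barrier is the admissible function here. Its order \<open>k\<close>
      positivity comes from \<open>sub\<close> and \<open>f \<ge> c\<^sub>0 > 0\<close>, the lower
      orders from the expansion.\<close>
    have lower: "b (1 + \<eta>) y \<le> u y" if y: "y \<in> \<Omega>" for y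
    proof (rule hessian_comparison[OF \<Omega> bC u(2) bcont u(3) _ _ _ y])
      fix z j assume z: "z \<in> \<Omega>" and j: "1 \<le> j" "j \<le> k"
      show "0 < sigma j (hessian (b (1 + \<eta>)) z)"
      proof (cases "j = k")
        case True
        then show ?thesis using sub[OF z] f[OF z] assms(6) by simp
      next
        case False
        then have "j \<le> m" using j k by simp
        then show ?thesis unfolding b_def by (intro K(3)) (use t \<eta> z in auto)
      qed
    qed (use sub u_eq u_bdry b_bdry in auto)
    \<comment> \<open>Now the solution itself is the admissible function, and the barrier only has
      to be a strict supersolution.\<close>
    have upper: "u y \<le> b (1 - \<eta>) y" if y: "y \<in> \<Omega>" for y
      by (rule hessian_comparison[OF \<Omega> u(2) bC u(3) bcont u_adm _ _ y]) (use sup u_eq u_bdry b_bdry in auto)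
    let ?l = "\<lambda>s. x + s *\<^sub>R outward_normal \<Omega> x"
    let ?D\<phi> = "normal_derivative \<Omega> (phi E) x"
    have inside: "\<forall>\<^sub>F s in at_left 0. ?l s \<in> \<Omega>"
      using outward_normal_props(2)[OF dom x] unfolding eventually_at_left_field
      by (metis neg_less_0_iff_less)
    have b_deriv: "((\<lambda>s. b a (?l s)) has_real_derivative t * ?D\<phi> + a / t ^ m * ?Dw x) (at_left 0)" for a
      unfolding b_def by (intro DERIV_add DERIV_cmult phi_deriv w_deriv x)
    obtain vu where "\<And>p. p \<in> frontier \<Omega> \<Longrightarrow> ((\<lambda>s. u (p + s *\<^sub>R outward_normal \<Omega> p))
        has_real_derivative (\<Sum>i\<in>UNIV. vu i p * outward_normal \<Omega> p $ i)) (at_left 0)"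
      using smooth_on_closure_normal_derivative[OF dom u(1)] by blast
    then obtain Du where u_deriv: "((\<lambda>s. u (?l s)) has_real_derivative Du) (at_left 0)"
      using x by blast
    have \<Lambda>x: "\<Lambda> ?g x = Du" using \<Lambda>[OF x] normal_derivative_eqI[OF u_deriv] by simp
    \<comment> \<open>The solution and the barrier agree at \<open>x\<close>, and the barrier lies
      below inside, so it has the larger outward derivative.\<close>
    have "Du \<le> t * ?D\<phi> + (1 + \<eta>) / t ^ m * ?Dw x"
      by (rule left_derivative_le[OF b_deriv u_deriv])
         (use x u_bdry b_bdry eventually_mono[OF inside lower] in auto)
    then have "t ^ m * (Du - t * ?D\<phi>) \<le> t ^ m * ((1 + \<eta>) / t ^ m * ?Dw x)"
      using t(1) by (intro mult_left_mono) auto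
    then have 1: "t ^ m * (Du - t * ?D\<phi>) \<le> (1 + \<eta>) * ?Dw x" using t(1) by simp
    have "t * ?D\<phi> + (1 - \<eta>) / t ^ m * ?Dw x \<le> Du"
      by (rule left_derivative_le[OF u_deriv b_deriv])
         (use x u_bdry b_bdry eventually_mono[OF inside upper] in auto)
    then have "t ^ m * ((1 - \<eta>) / t ^ m * ?Dw x) \<le> t ^ m * (Du - t * ?D\<phi>)"
      using t(1) by (intro mult_left_mono) auto
    then have 2: "(1 - \<eta>) * ?Dw x \<le> t ^ m * (Du - t * ?D\<phi>)" using t(1) by simp
    have "\<bar>t ^ m * (Du - t * ?D\<phi>) - ?Dw x\<bar> \<le> \<eta> * ?Dw x"
      using 1 2 by (simp add: abs_le_iff algebra_simps)
    also have "\<dots> \<le> \<eta> * C1" using Dw_bound[OF x] \<eta> by (intro mult_left_mono) auto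
    finally show ?thesis unfolding \<Lambda>x Dw[OF x] .
  qed
  have "uniform_limit (frontier \<Omega>)
      (\<lambda>t x. t ^ m * (\<Lambda> (\<lambda>y. t * phi E y) x - t * normal_derivative \<Omega> (phi E) x))
      (\<lambda>x. normal_derivative \<Omega> w x) at_top"
    unfolding uniform_limit_iff
  proof (intro allI impI)
    fix e :: real assume e: "0 < e"
    \<comment> \<open>The cap 1 keeps \<open>1 - \<eta>\<close> and \<open>1 + \<eta>\<close>
      between 0 and 2; dividing by \<open>C1 + 1\<close> makes \<open>\<eta> * C1 < e\<close> even
      when \<open>C1 = 0\<close>.\<close>
    define \<eta> where "\<eta> = min 1 (e / (C1 + 1))"
    have \<eta>: "0 < \<eta>" "\<eta> \<le> 1" using e C1 by (auto simp: \<eta>_def)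
    have "\<eta> * C1 \<le> e / (C1 + 1) * C1" using C1 by (intro mult_right_mono) (auto simp: \<eta>_def)
    also have "\<dots> < e" using e C1 by (simp add: divide_less_eq)
    finally have \<eta>C: "\<eta> * C1 < e" .
    have \<eta>c: "0 < \<eta> * c\<^sub>0" using \<eta> assms(6) by simp
    show "\<forall>\<^sub>F t in at_top. \<forall>x\<in>frontier \<Omega>. dist (t ^ m *
        (\<Lambda> (\<lambda>y. t * phi E y) x - t * normal_derivative \<Omega> (phi E) x)) (normal_derivative \<Omega> w x) < e"
      \<comment> \<open>The sum of three nonnegative thresholds dominates each of them, and the
        summand 1 makes the last two strict.\<close>
      using eventually_ge_at_top[of "1 + K + K / (\<eta> * c\<^sub>0)"]
    proof eventually_elim
      case (elim t)
      have "0 \<le> K / (\<eta> * c\<^sub>0)" using K(1) \<eta>c by simp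
      then have t: "1 \<le> t" "K < t" "K / (\<eta> * c\<^sub>0) < t" using elim K(1) by auto
      then have "K / t < 1" "K / t < \<eta> * c\<^sub>0" using \<eta>c by (simp_all add: divide_less_eq mult.commute)
      then show ?case
        using estimate[OF t(1) _ _ \<eta>] \<eta>C unfolding dist_real_def by (meson le_less_trans)
    qed
  qed
  moreover have "nontangential_boundary \<Omega> V \<inter> UNIV \<subseteq> frontier \<Omega>"
    by (auto simp: nontangential_boundary_def)
  ultimately have lim: "uniform_limit (nontangential_boundary \<Omega> V \<inter> UNIV)
      (\<lambda>t x. t ^ m * (\<Lambda> (\<lambda>y. t * phi E y) x - t * normal_derivative \<Omega> (phi E) x))
      (\<lambda>x. normal_derivative \<Omega> w x) at_top"
    by (rule uniform_limit_on_subset)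
  have m: "k - 1 = m" using k by simp
  show ?thesis
    unfolding locally_uniform_limit_def m
    \<comment> \<open>The convergence is uniform in \<open>x\<close>, so the single open set
      \<open>UNIV\<close> serves every point.\<close>
    by (intro ballI exI[of _ UNIV] conjI open_UNIV UNIV_I lim)
qed

end
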